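(* Let $A$ be a finite alphabet, $\theta$ a commutation relation on $A$, and $L\subseteq\mathcal{A}(2,A)$. Then $L$ is a transitive Lazard set for $(A,\theta)$ if and only if $L$ is a transitive Hall set for $(A,\theta)$, i.e. there is a total order $<$ on $L$ making $(L,<)$ a transitive Hall set.
   Context: $\theta\subseteq A\times A\setminus\{(a,a)\}$ is symmetric; $\mathbb{M}(A,\theta)$ is the trace monoid (quotient of $A^*$ by $ab=ba$ for $(a,b)\in\theta$). $\mathcal{A}(2,A)$ is the free magma on $A$ (binary trees with leaves in $A$, product $(t_1,t_2)$), $\mathcal{A}(2,A)^{\le n}$ the trees with at most $n$ leaves; $f:\mathcal{A}(2,A)\to\mathbb{M}(A,\theta)$ is the magma morphism that is the identity on $A$. $\theta_{\mathbb{M}}=\{(w,w')\mid ww'=w'w,\ \mathrm{Alph}(w)\cap\mathrm{Alph}(w')=\emptyset\}$. A complete factorization of $\mathbb{M}(A,\theta)$ is a totally ordered family $(y_i)_{i\in J}$ of traces such that every trace can be written uniquely as an ordered product $\prod_i y_i^{e_i}$ (in the given order of $J$, finitely many $e_i\neq0$). Transitive Hall set: a set $H\subseteq\mathcal{A}(2,A)$ with a total order $<$ such that (1) $(f(h))_{h\in H}$ is a complete factorization of $\mathbb{M}(A,\theta)$ for the reverse order of $<$; (2) $A\subseteq H$; (3) if $h=(h',h'')\in H\setminus A$ then $h''\in H$ and $h<h''$; (4) for $h=(h',h'')\in\mathcal{A}(2,A)\setminus A$, $h\in H$ iff: $h',h''\in H$; $h'<h''$; $(f(h'),f(h''))\notin\theta_{\mathbb{M}}$;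 and either $h'\in A$ or $h'=(x,y)$ with $y\ge h''$. Transitive Lazard set: graphs considered have finite vertex sets $V\subseteq\mathcal{A}(2,A)$, with $\{t_1,t_2\}$ an edge iff $(f(t_1),f(t_2))\in\theta_{\mathbb{M}}$. An elimination string of $(V,E)$ is a tuple $(a_1,\dots,a_k)$ of distinct vertices such that for each $i$ and all $v_1,v_2\in V\setminus\{a_1,\dots,a_i\}$, $\{v_1,v_2\}\in E$ implies $\{v_1,a_i\}\in E$ or $\{v_2,a_i\}\in E$; $a_1$ is its starting point; it is complete if $\{a_1,\dots,a_k\}=V$. Writing $(t\,v^m)$ for the left comb $(\dots((t,v),v)\dots,v)$ with $m$ copies of $v$, the H-star $G_n^{*v}$ of $G=(V,E)$ has vertex set $((V\cap\mathcal{A}(2,A)^{\le n})\setminus\{v\})\cup\{(v'\,v^m)\in\mathcal{A}(2,A)^{\le n}\mid m>0,\ v'\in V\setminus\{v\},\ \{v',v\}\notin E\}$ and edges the pairs whose foliages are in $\theta_{\mathbb{M}}$. $L$ is a transitive Lazard set for $(A,\theta)$ if for each $n>0$ one can enumerate $L\cap\mathcal{A}(2,A)^{\le n}=\{s_1,\dots,s_k\}$ so that there exist graphs $G_1,\dots,G_{k+1}$ with: $G_1=(A,\theta)$ (vertex set $A$, edge set $\theta$); $G_{k+1}$ empty; each $s_i$ is a vertex of $G_i$ and the starting point of a complete elimination string of $G_i$; and $G_{i+1}=(G_i)_n^{*s_i}$. *)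

theory Defs
  imports "HOL-Algebra.Group"
begin

section \<open>The trace monoid\<close>

inductive_set trace_cong :: "'a set \<Rightarrow> ('a \<times> 'a) set \<Rightarrow> ('a list \<times> 'a list) set"
  for A :: "'a set" and \<theta> :: "('a \<times> 'a) set" where
  swap: "(a, b) \<in> \<theta> \<Longrightarrow> a \<in> A \<Longrightarrow> b \<in> A \<Longrightarrow> ([a, b], [b, a]) \<in> trace_cong A \<theta>"
| refl: "w \<in> lists A \<Longrightarrow> (w, w) \<in> trace_cong A \<theta>"
| sym: "(u, v) \<in> trace_cong A \<theta> \<Longrightarrow> (v, u) \<in> trace_cong A \<theta>"
| trans: "(u, v) \<in> trace_cong A \<theta> \<Longrightarrow> (v, w) \<in> trace_cong A \<theta> \<Longrightarrow> (u, w) \<in> trace_cong A \<theta>"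
| append: "(u, u') \<in> trace_cong A \<theta> \<Longrightarrow> (v, v') \<in> trace_cong A \<theta>
    \<Longrightarrow> (u @ v, u' @ v') \<in> trace_cong A \<theta>"

definition trace_monoid :: "'a set \<Rightarrow> ('a \<times> 'a) set \<Rightarrow> 'a list set monoid" where
  "trace_monoid A \<theta> =
    \<lparr>carrier = lists A // trace_cong A \<theta>,
     mult = (\<lambda>X Y. trace_cong A \<theta> `` {x @ y |x y. x \<in> X \<and> y \<in> Y}),
     one = trace_cong A \<theta> `` {[]}\<rparr>"

lemma equiv_trace_cong: "equiv (lists A) (trace_cong A \<theta>)"
proof -
  have "u \<in> lists A \<and> v \<in> lists A" if "(u, v) \<in> trace_cong A \<theta>" for u v
    using that by induction auto
  then have "trace_cong A \<theta> \<subseteq> lists A \<times> lists A"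
    by auto
  then show ?thesis
    by (intro equivI refl_onI symI transI)
      (auto intro: trace_cong.refl trace_cong.sym trace_cong.trans)
qed

lemma trace_mult_class:
  assumes "u \<in> lists A" and "v \<in> lists A"
  shows "trace_cong A \<theta> `` {u} \<otimes>\<^bsub>trace_monoid A \<theta>\<^esub> trace_cong A \<theta> `` {v}
    = trace_cong A \<theta> `` {u @ v}"
  using assms unfolding trace_monoid_def
  by (auto simp del: append_in_lists_conv intro: trace_cong.trans trace_cong.append
      intro!: trace_cong.refl exI)

lemma monoid_trace_monoid: "monoid (trace_monoid A \<theta>)"
proof
  let ?M = "trace_monoid A \<theta>" and ?c = "\<lambda>u. trace_cong A \<theta> `` {u}"
  have car: "X \<in> carrier ?M \<longleftrightarrow> (\<exists>u \<in> lists A. X = ?c u)" for X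
    by (auto simp: trace_monoid_def quotient_def)
  have one: "\<one>\<^bsub>?M\<^esub> = ?c []"
    by (simp add: trace_monoid_def)
  show "\<one>\<^bsub>?M\<^esub> \<in> carrier ?M"
    using one by (auto simp: car intro!: bexI[of _ "[]"])
  show "X \<otimes>\<^bsub>?M\<^esub> Y \<in> carrier ?M" if "X \<in> carrier ?M" "Y \<in> carrier ?M" for X Y
  proof -
    from that obtain u v where "u \<in> lists A" "v \<in> lists A" "X = ?c u" "Y = ?c v"
      by (auto simp: car)
    then show ?thesis
      unfolding car by (intro bexI[of _ "u @ v"]) (simp_all add: trace_mult_class)
  qed
  show "X \<otimes>\<^bsub>?M\<^esub> Y \<otimes>\<^bsub>?M\<^esub> Z = X \<otimes>\<^bsub>?M\<^esub> (Y \<otimes>\<^bsub>?M\<^esub> Z)"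
    if "X \<in> carrier ?M" "Y \<in> carrier ?M" "Z \<in> carrier ?M" for X Y Z
  proof -
    from that obtain u v w where "u \<in> lists A" "v \<in> lists A" "w \<in> lists A"
      "X = ?c u" "Y = ?c v" "Z = ?c w"
      by (auto simp: car)
    then show ?thesis
      by (simp add: trace_mult_class)
  qed
  show "\<one>\<^bsub>?M\<^esub> \<otimes>\<^bsub>?M\<^esub> X = X" "X \<otimes>\<^bsub>?M\<^esub> \<one>\<^bsub>?M\<^esub> = X" if "X \<in> carrier ?M" for X
  proof -
    from that obtain u where "u \<in> lists A" "X = ?c u"
      by (auto simp: car)
    then show "\<one>\<^bsub>?M\<^esub> \<otimes>\<^bsub>?M\<^esub> X = X" "X \<otimes>\<^bsub>?M\<^esub> \<one>\<^bsub>?M\<^esub> = X"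
      by (simp_all add: one trace_mult_class)
  qed
qed

text \<open>All words in a trace have the same letters, so the union below is the set of letters of any
  representative.\<close>

definition Alph :: "'a list set \<Rightarrow> 'a set" where
  "Alph W = (\<Union>w\<in>W. set w)"

definition trace_commutation ::
    "'a set \<Rightarrow> ('a \<times> 'a) set \<Rightarrow> ('a list set \<times> 'a list set) set" where
  "trace_commutation A \<theta> =
    {(w, w'). w \<in> carrier (trace_monoid A \<theta>) \<and> w' \<in> carrier (trace_monoid A \<theta>)
       \<and> w \<otimes>\<^bsub>trace_monoid A \<theta>\<^esub> w' = w' \<otimes>\<^bsub>trace_monoid A \<theta>\<^esub> w
       \<and> Alph w \<inter> Alph w' = {}}"

section \<open>The free magma and foliages\<close>

datatype (leaves: 'a) mtree = Letter 'a | Br "'a mtree" "'a mtree"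

definition free_magma :: "'a set \<Rightarrow> 'a mtree set" where
  "free_magma A = {t. leaves t \<subseteq> A}"

primrec num_leaves :: "'a mtree \<Rightarrow> nat" where
  "num_leaves (Letter a) = 1"
| "num_leaves (Br s t) = num_leaves s + num_leaves t"

definition free_magma_le :: "'a set \<Rightarrow> nat \<Rightarrow> 'a mtree set" where
  "free_magma_le A n = {t \<in> free_magma A. num_leaves t \<le> n}"

primrec foliage :: "'a set \<Rightarrow> ('a \<times> 'a) set \<Rightarrow> 'a mtree \<Rightarrow> 'a list set" where
  "foliage A \<theta> (Letter a) = trace_cong A \<theta> `` {[a]}"
| "foliage A \<theta> (Br s t) = foliage A \<theta> s \<otimes>\<^bsub>trace_monoid A \<theta>\<^esub> foliage A \<theta> t"

primrec left_comb :: "'a mtree \<Rightarrow> 'a mtree \<Rightarrow> nat \<Rightarrow> 'a mtree" where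
  "left_comb t v 0 = t"
| "left_comb t v (Suc m) = Br (left_comb t v m) v"

section \<open>Complete factorizations\<close>

text \<open>\<open>r\<close> is a reflexive linear order; the factors are multiplied from the \<open>r\<close>-least index
  to the \<open>r\<close>-greatest one.\<close>

definition ordered_support :: "('i \<times> 'i) set \<Rightarrow> ('i \<Rightarrow> nat) \<Rightarrow> 'i list" where
  "ordered_support r e =
    (THE xs. distinct xs \<and> set xs = {i. e i \<noteq> 0} \<and> sorted_wrt (\<lambda>i j. (i, j) \<in> r) xs)"

definition ordered_prod ::
    "('m, 'b) monoid_scheme \<Rightarrow> ('i \<times> 'i) set \<Rightarrow> ('i \<Rightarrow> 'm) \<Rightarrow> ('i \<Rightarrow> nat) \<Rightarrow> 'm" where
  "ordered_prod M r y e =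
    foldr (mult M) (map (\<lambda>i. y i [^]\<^bsub>M\<^esub> e i) (ordered_support r e)) \<one>\<^bsub>M\<^esub>"

definition complete_factorization ::
    "('m, 'b) monoid_scheme \<Rightarrow> 'i set \<Rightarrow> ('i \<times> 'i) set \<Rightarrow> ('i \<Rightarrow> 'm) \<Rightarrow> bool" where
  "complete_factorization M J r y \<longleftrightarrow>
    linear_order_on J r \<and> y ` J \<subseteq> carrier M \<and>
    (\<forall>w \<in> carrier M. \<exists>!e. finite {i. e i \<noteq> 0} \<and> {i. e i \<noteq> 0} \<subseteq> J \<and> w = ordered_prod M r y e)"

section \<open>Transitive Hall sets\<close>

text \<open>\<open>(x, y) \<in> r\<close> reads \<open>x \<le> y\<close>.\<close>

definition transitive_Hall_set ::
    "'a set \<Rightarrow> ('a \<times> 'a) set \<Rightarrow> 'a mtree set \<Rightarrow> ('a mtree \<times> 'a mtree) set \<Rightarrow> bool" where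
  "transitive_Hall_set A \<theta> H r \<longleftrightarrow>
    H \<subseteq> free_magma A \<and>
    linear_order_on H r \<and>
    complete_factorization (trace_monoid A \<theta>) H (r\<inverse>) (foliage A \<theta>) \<and>
    Letter ` A \<subseteq> H \<and>
    (\<forall>h' h''. Br h' h'' \<in> H \<longrightarrow> h'' \<in> H \<and> (Br h' h'', h'') \<in> r \<and> Br h' h'' \<noteq> h'') \<and>
    (\<forall>h' h''. Br h' h'' \<in> free_magma A \<longrightarrow>
      (Br h' h'' \<in> H \<longleftrightarrow>
        h' \<in> H \<and> h'' \<in> H \<and>
        (h', h'') \<in> r \<and> h' \<noteq> h'' \<and>
        (foliage A \<theta> h', foliage A \<theta> h'') \<notin> trace_commutation A \<theta> \<and>
        (h' \<in> Letter ` A \<or> (\<exists>x y. h' = Br x y \<and> (h'', y) \<in> r))))"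

section \<open>Transitive Lazard sets\<close>

text \<open>A graph is a set of vertices with a set of unordered pairs of vertices.\<close>

type_synonym 'a tree_graph = "'a mtree set \<times> 'a mtree set set"

definition alphabet_graph :: "'a set \<Rightarrow> ('a \<times> 'a) set \<Rightarrow> 'a tree_graph" where
  "alphabet_graph A \<theta> = (Letter ` A, {{Letter a, Letter b} |a b. (a, b) \<in> \<theta>})"

definition commutation_graph :: "'a set \<Rightarrow> ('a \<times> 'a) set \<Rightarrow> 'a mtree set \<Rightarrow> 'a tree_graph" where
  "commutation_graph A \<theta> V =
    (V, {{s, t} |s t. s \<in> V \<and> t \<in> V \<and> (foliage A \<theta> s, foliage A \<theta> t) \<in> trace_commutation A \<theta>})"

definition elimination_string :: "'a tree_graph \<Rightarrow> 'a mtree list \<Rightarrow> bool" where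
  "elimination_string G as \<longleftrightarrow>
    distinct as \<and> set as \<subseteq> fst G \<and>
    (\<forall>i < length as. \<forall>v\<^sub>1 \<in> fst G - set (take (Suc i) as). \<forall>v\<^sub>2 \<in> fst G - set (take (Suc i) as).
      {v\<^sub>1, v\<^sub>2} \<in> snd G \<longrightarrow> {v\<^sub>1, as ! i} \<in> snd G \<or> {v\<^sub>2, as ! i} \<in> snd G)"

definition complete_elimination_string :: "'a tree_graph \<Rightarrow> 'a mtree list \<Rightarrow> bool" where
  "complete_elimination_string G as \<longleftrightarrow> elimination_string G as \<and> set as = fst G"

definition H_star ::
    "'a set \<Rightarrow> ('a \<times> 'a) set \<Rightarrow> nat \<Rightarrow> 'a mtree \<Rightarrow> 'a tree_graph \<Rightarrow> 'a tree_graph" where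
  "H_star A \<theta> n v G = commutation_graph A \<theta>
    ((fst G \<inter> free_magma_le A n - {v}) \<union>
     {left_comb v' v m |v' m. left_comb v' v m \<in> free_magma_le A n \<and> m > 0
        \<and> v' \<in> fst G - {v} \<and> {v', v} \<notin> snd G})"

text \<open>Indices are shifted to start at \<open>0\<close>: the list \<open>ss\<close> enumerates the truncation of \<open>L\<close>,
  and \<open>G 0, \<dots>, G (length ss)\<close> are the successive graphs.\<close>

definition transitive_Lazard_set ::
    "'a set \<Rightarrow> ('a \<times> 'a) set \<Rightarrow> 'a mtree set \<Rightarrow> bool" where
  "transitive_Lazard_set A \<theta> L \<longleftrightarrow>
    (\<forall>n > 0. \<exists>ss (G :: nat \<Rightarrow> 'a tree_graph).
      distinct ss \<and> set ss = L \<inter> free_magma_le A n \<and>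
      G 0 = alphabet_graph A \<theta> \<and>
      G (length ss) = ({}, {}) \<and>
      (\<forall>i < length ss.
        ss ! i \<in> fst (G i) \<and>
        (\<exists>as. complete_elimination_string (G i) as \<and> as \<noteq> [] \<and> hd as = ss ! i) \<and>
        G (Suc i) = H_star A \<theta> n (ss ! i) (G i)))"

end

theory Submission
  imports Defs "HOL-Library.Multiset"
begin

text \<open>Two foliages are in the commutation relation iff all their letters commute, so graphs of trees
  are determined by leaves. Eliminating a vertex \<open>s\<close> rewrites a word over \<open>V\<close> as \<open>s\<^sup>k\<close> followed by a word
  over the star of \<open>V\<close>; the elimination condition on \<open>s\<close> is exactly what makes this compatible with
  commutations. Iterating along a Lazard enumeration yields the unique decreasing factorization of
  every trace of bounded length. Conversely, in the decreasing enumeration of a Hall set the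
  \<open>i\<close>-th graph consists of the remaining trees whose right factor is already eliminated, and a failure
  of the elimination condition would give some trace two factorizations.\<close>

section \<open>Traces and foliages\<close>

text \<open>The argument splits into two independent correspondences. Successive H-stars that end in
  the empty set match the Hall rules on trees; this is a statement about vertex sets alone
  (\<open>lazard_run\<close> against \<open>hall_rules\<close>). The elimination condition matches
  uniqueness of the factorization. Uniqueness is obtained without counting traces and without
  inverting the rewriting. The normal form is constant on traces, and every decreasing list is the
  normal form of its own underlying word; so two decreasing lists with congruent words coincide.
  Working with at most \<open>n\<close> leaves does no harm, because the length of a word is a trace
  invariant: a word of length at most \<open>n\<close> only ever produces trees with at most
  \<open>n\<close> leaves. The remaining obstacle is global. A Lazard set provides one enumeration
  for each degree, and nothing forces enumerations for different degrees to order common trees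
  alike. A single order on all of \<open>L\<close> has to be assembled from them, which is possible
  because each truncation is finite.\<close>

lemma trace_cong_Cons:
  assumes "a \<in> A" "(u, v) \<in> trace_cong A \<theta>"
  shows "(a # u, a # v) \<in> trace_cong A \<theta>"
  using trace_cong.append[OF trace_cong.refl[of "[a]" A \<theta>] assms(2)] assms(1) by simp

lemma trace_cong_mset: "(u, v) \<in> trace_cong A \<theta> \<Longrightarrow> mset u = mset v"
  by (induction rule: trace_cong.induct) auto

lemma trace_cong_set: "(u, v) \<in> trace_cong A \<theta> \<Longrightarrow> set u = set v"
  by (metis trace_cong_mset set_mset_mset)

lemma trace_cong_length: "(u, v) \<in> trace_cong A \<theta> \<Longrightarrow> length u = length v"
  by (metis trace_cong_mset size_mset)

lemma trace_class_eq_iff: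
  assumes "set u \<subseteq> A" "set v \<subseteq> A"
  shows "trace_cong A \<theta> `` {u} = trace_cong A \<theta> `` {v} \<longleftrightarrow> (u, v) \<in> trace_cong A \<theta>"
  using assms equiv_trace_cong[of A \<theta>] by (simp add: eq_equiv_class_iff lists_eq_set)

lemma Alph_class:
  assumes "set u \<subseteq> A"
  shows "Alph (trace_cong A \<theta> `` {u}) = set u"
  using trace_cong.refl[of u A \<theta>] assms by (auto simp: lists_eq_set Alph_def dest: trace_cong_set)

lemma trace_cong_commute1:
  assumes "a \<in> A" "set v \<subseteq> A" "{a} \<times> set v \<subseteq> \<theta>"
  shows "(a # v, v @ [a]) \<in> trace_cong A \<theta>"
  using assms(2,3)
proof (induction v)
  case Nil
  then show ?case using assms(1) by (simp add: trace_cong.refl)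
next
  case (Cons b v)
  have "([a, b] @ v, [b, a] @ v) \<in> trace_cong A \<theta>"
    using Cons.prems assms(1)
    by (intro trace_cong.append trace_cong.swap trace_cong.refl) (auto simp: lists_eq_set)
  moreover have "(b # (a # v), b # (v @ [a])) \<in> trace_cong A \<theta>"
    using Cons by (intro trace_cong_Cons) auto
  ultimately show ?case by (auto intro: trace_cong.trans)
qed

lemma trace_cong_commute:
  assumes "set u \<subseteq> A" "set v \<subseteq> A" "set u \<times> set v \<subseteq> \<theta>"
  shows "(u @ v, v @ u) \<in> trace_cong A \<theta>"
  using assms(1,3)
proof (induction u)
  case Nil
  then show ?case using assms(2) by (simp add: trace_cong.refl lists_eq_set)
next
  case (Cons a u)
  have "(a # (u @ v), a # (v @ u)) \<in> trace_cong A \<theta>"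
    using Cons by (intro trace_cong_Cons) auto
  moreover have "((a # v) @ u, (v @ [a]) @ u) \<in> trace_cong A \<theta>"
    using Cons assms(2)
    by (intro trace_cong.append trace_cong_commute1 trace_cong.refl) (auto simp: lists_eq_set)
  ultimately show ?case by (auto intro: trace_cong.trans)
qed

text \<open>A swap alters the projection to two letters only if it exchanges exactly these two, and
  a noncommuting pair is never exchanged. This is the invariant by which noncommutation of traces is
  detected.\<close>

lemma trace_cong_proj:
  assumes "(u, v) \<in> trace_cong A \<theta>" "sym \<theta>" "irrefl \<theta>" "(a, b) \<notin> \<theta>"
  shows "filter (\<lambda>c. c = a \<or> c = b) u = filter (\<lambda>c. c = a \<or> c = b) v"
  using assms(1)
proof induction
  case (swap c d)
  then show ?case using assms(2-4) by (auto dest: symD irreflD)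
qed auto

section \<open>Representative words of trees, and commutation of foliages\<close>

primrec word :: "'a mtree \<Rightarrow> 'a list" where
  "word (Letter a) = [a]"
| "word (Br s t) = word s @ word t"

abbreviation words :: "'a mtree list \<Rightarrow> 'a list" where
  "words x \<equiv> concat (map word x)"

lemma set_word [simp]: "set (word t) = leaves t"
  by (induction t) auto

lemma length_word [simp]: "length (word t) = num_leaves t"
  by (induction t) auto

lemma num_leaves_pos [simp]: "num_leaves t > 0"
  by (induction t) auto

lemma leaves_nonempty [simp]: "leaves t \<noteq> {}"
  by (induction t) auto

lemma free_magma_simps [simp]:
  "Letter a \<in> free_magma A \<longleftrightarrow> a \<in> A"
  "Br s t \<in> free_magma A \<longleftrightarrow> s \<in> free_magma A \<and> t \<in> free_magma A"
  by (auto simp: free_magma_def)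

lemma leaves_free_magma: "t \<in> free_magma A \<Longrightarrow> leaves t \<subseteq> A"
  by (simp add: free_magma_def)

lemma set_words_free_magma: "set x \<subseteq> free_magma A \<Longrightarrow> set (words x) \<subseteq> A"
  by (fastforce simp: free_magma_def)

lemma num_leaves_le_words: "t \<in> set x \<Longrightarrow> num_leaves t \<le> length (words x)"
  by (induction x) auto

lemma foliage_eq_class:
  "t \<in> free_magma A \<Longrightarrow> foliage A \<theta> t = trace_cong A \<theta> `` {word t}"
  by (induction t) (simp_all add: trace_mult_class leaves_free_magma lists_eq_set)

lemma foliage_in_carrier: "t \<in> free_magma A \<Longrightarrow> foliage A \<theta> t \<in> carrier (trace_monoid A \<theta>)"
  by (simp add: foliage_eq_class trace_monoid_def quotientI lists_eq_set leaves_free_magma)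

definition indep :: "('a \<times> 'a) set \<Rightarrow> 'a mtree \<Rightarrow> 'a mtree \<Rightarrow> bool" where
  "indep \<theta> s t \<longleftrightarrow> leaves s \<times> leaves t \<subseteq> \<theta>"

lemma indep_sym: "sym \<theta> \<Longrightarrow> indep \<theta> s t \<Longrightarrow> indep \<theta> t s"
  by (auto simp: indep_def dest: symD)

lemma indep_Br [simp]:
  "indep \<theta> (Br s t) u \<longleftrightarrow> indep \<theta> s u \<and> indep \<theta> t u"
  "indep \<theta> u (Br s t) \<longleftrightarrow> indep \<theta> u s \<and> indep \<theta> u t"
  by (auto simp: indep_def)

lemma not_indep_self: "irrefl \<theta> \<Longrightarrow> \<not> indep \<theta> t t"
  using leaves_nonempty[of t] by (fastforce simp: indep_def irrefl_def)

lemma trace_commutation_foliage: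
  assumes "sym \<theta>" "irrefl \<theta>" "s \<in> free_magma A" "t \<in> free_magma A"
  shows "(foliage A \<theta> s, foliage A \<theta> t) \<in> trace_commutation A \<theta> \<longleftrightarrow> indep \<theta> s t"
proof -
  have w: "leaves s \<subseteq> A" "leaves t \<subseteq> A"
    using assms by (auto dest: leaves_free_magma)
  have "(foliage A \<theta> s, foliage A \<theta> t) \<in> trace_commutation A \<theta> \<longleftrightarrow>
      (word s @ word t, word t @ word s) \<in> trace_cong A \<theta> \<and> leaves s \<inter> leaves t = {}"
    using assms w unfolding trace_commutation_def
    by (simp add: foliage_in_carrier) (simp add: foliage_eq_class trace_mult_class Alph_class
        trace_class_eq_iff lists_eq_set)
  also have "\<dots> \<longleftrightarrow> indep \<theta> s t"
  proof
    assume L: "(word s @ word t, word t @ word s) \<in> trace_cong A \<theta> \<and> leaves s \<inter> leaves t = {}"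
    show "indep \<theta> s t"
      unfolding indep_def
    proof (clarify, rule ccontr)
      fix a b assume ab: "a \<in> leaves s" "b \<in> leaves t" "(a, b) \<notin> \<theta>"
      \<comment> \<open>Both projections to a noncommuting pair are nonempty. If the two products
        are congruent, comparing first letters of the projections yields a letter common to
        \<open>s\<close> and \<open>t\<close>, against disjointness.\<close>
      define P where "P = (\<lambda>c. c = a \<or> c = b)"
      have "filter P (word s) @ filter P (word t) = filter P (word t) @ filter P (word s)"
        using trace_cong_proj[OF conjunct1[OF L] assms(1,2) ab(3)] by (simp add: P_def)
      moreover have ne: "filter P (word s) \<noteq> []" "filter P (word t) \<noteq> []"
        using ab by (auto simp: P_def filter_empty_conv)
      ultimately have "hd (filter P (word s)) = hd (filter P (word t))"
        using hd_append2[OF ne(1)] hd_append2[OF ne(2)] by metis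
      moreover have "hd (filter P (word s)) \<in> leaves s" "hd (filter P (word t)) \<in> leaves t"
        using hd_in_set[OF ne(1)] hd_in_set[OF ne(2)] by auto
      ultimately show False using L by auto
    qed
  next
    assume "indep \<theta> s t"
    then show "(word s @ word t, word t @ word s) \<in> trace_cong A \<theta> \<and> leaves s \<inter> leaves t = {}"
      using assms(2) w by (auto simp: indep_def irrefl_def intro!: trace_cong_commute)
  qed
  finally show ?thesis .
qed


section \<open>Factorizations as sorted lists\<close>

lemma sorted_wrt_mset_unique:
  assumes "antisym R" "sorted_wrt (\<lambda>i j. (i, j) \<in> R) xs" "sorted_wrt (\<lambda>i j. (i, j) \<in> R) ys"
    "mset xs = mset ys"
  shows "xs = ys"
  using assms(2-4)
proof (induction xs arbitrary: ys)
  case (Cons x xs)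
  then obtain y ys' where ys: "ys = y # ys'"
    by (cases ys) auto
  have "x \<in> set ys" "y \<in> set (x # xs)"
    using Cons.prems(3) ys by (metis list.set_intros(1) set_mset_mset)+
  then have "x = y"
    using Cons.prems(1,2) ys assms(1) by (auto dest: antisymD)
  then show ?case using Cons ys by auto
qed auto

lemma ex_sorted_wrt_add_mset:
  assumes "linear_order_on J R" "x \<in> J" "set ys \<subseteq> J" "sorted_wrt (\<lambda>i j. (i, j) \<in> R) ys"
  shows "\<exists>zs. sorted_wrt (\<lambda>i j. (i, j) \<in> R) zs \<and> mset zs = add_mset x (mset ys)"
  using assms(3,4)
proof (induction ys)
  case Nil
  show ?case by (intro exI[of _ "[x]"]) auto
next
  case (Cons y ys)
  have R: "refl_on J R" "trans R" "total_on J R"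
    using assms(1) by (auto simp: order_on_defs)
  show ?case
  proof (cases "(x, y) \<in> R")
    case True
    then show ?thesis
      using Cons.prems R(2) by (intro exI[of _ "x # y # ys"]) (auto dest: transD)
  next
    case False
    then have "(y, x) \<in> R"
      using R(1,3) assms(2) Cons.prems(1) by (cases "x = y") (auto simp: refl_on_def total_on_def)
    moreover obtain zs where zs: "sorted_wrt (\<lambda>i j. (i, j) \<in> R) zs" "mset zs = add_mset x (mset ys)"
      using Cons by auto
    moreover have "set zs = insert x (set ys)"
      by (metis zs(2) set_mset_add_mset_insert set_mset_mset)
    ultimately show ?thesis
      using Cons.prems by (intro exI[of _ "y # zs"]) auto
  qed
qed

lemma ex_sorted_wrt_mset:
  assumes "linear_order_on J R" "set xs \<subseteq> J"
  shows "\<exists>ys. sorted_wrt (\<lambda>i j. (i, j) \<in> R) ys \<and> mset ys = mset xs"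
  using assms(2)
proof (induction xs)
  case (Cons x xs)
  then obtain ys where "sorted_wrt (\<lambda>i j. (i, j) \<in> R) ys" "mset ys = mset xs"
    by auto
  moreover from this have "set ys \<subseteq> J"
    using Cons.prems by (metis set_mset_mset set_subset_Cons subset_trans)
  ultimately show ?case
    using ex_sorted_wrt_add_mset[OF assms(1), of x ys] Cons.prems by auto
qed auto

text \<open>\<open>ordered_support\<close> is a definite description; it is meaningful because a
  finite subset of a linear order has exactly one increasing enumeration.\<close>

lemma ordered_support:
  assumes "linear_order_on J R" "finite {i. e i \<noteq> 0}" "{i. e i \<noteq> 0} \<subseteq> J"
  shows "distinct (ordered_support R e)" "set (ordered_support R e) = {i. e i \<noteq> 0}"
    "sorted_wrt (\<lambda>i j. (i, j) \<in> R) (ordered_support R e)"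
proof -
  let ?P = "\<lambda>xs. distinct xs \<and> set xs = {i. e i \<noteq> 0} \<and> sorted_wrt (\<lambda>i j. (i, j) \<in> R) xs"
  obtain xs where xs: "set xs = {i. e i \<noteq> 0}" "distinct xs"
    using finite_distinct_list[OF assms(2)] by auto
  obtain ys where ys: "sorted_wrt (\<lambda>i j. (i, j) \<in> R) ys" "mset ys = mset xs"
    using ex_sorted_wrt_mset[OF assms(1), of xs] assms(3) xs by auto
  have "?P ys"
    using xs ys by (metis mset_eq_imp_distinct_iff mset_eq_setD)
  moreover have "zs = ys" if "?P zs" for zs
  proof (rule sorted_wrt_mset_unique[of R])
    show "mset zs = mset ys"
      using that \<open>?P ys\<close> set_eq_iff_mset_eq_distinct by blast
  qed (use that \<open>?P ys\<close> assms(1) in \<open>auto simp: order_on_defs\<close>)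
  ultimately have "?P (ordered_support R e)"
    unfolding ordered_support_def by (rule theI)
  then show "distinct (ordered_support R e)" "set (ordered_support R e) = {i. e i \<noteq> 0}"
    "sorted_wrt (\<lambda>i j. (i, j) \<in> R) (ordered_support R e)"
    by auto
qed

text \<open>Writes each power as repeated factors. A factorization thereby becomes a sorted list
  with repetitions, which elimination can process, instead of an exponent function.\<close>

definition expand :: "('i \<Rightarrow> nat) \<Rightarrow> 'i list \<Rightarrow> 'i list" where
  "expand e xs = concat (map (\<lambda>i. replicate (e i) i) xs)"

lemma count_expand:
  "distinct xs \<Longrightarrow> count (mset (expand e xs)) i = (if i \<in> set xs then e i else 0)"
  by (induction xs) (auto simp: expand_def)

lemma set_expand_subset: "set (expand e xs) \<subseteq> set xs"
  by (auto simp: expand_def)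

lemma sorted_wrt_expand:
  assumes "refl_on J R" "set xs \<subseteq> J" "sorted_wrt (\<lambda>i j. (i, j) \<in> R) xs"
  shows "sorted_wrt (\<lambda>i j. (i, j) \<in> R) (expand e xs)"
  using assms(2,3)
proof (induction xs)
  case (Cons x xs)
  have "sorted_wrt (\<lambda>i j. (i, j) \<in> R) (replicate n x)" for n
    using Cons.prems(1) assms(1) by (induction n) (auto simp: refl_on_def)
  then show ?case
    using Cons set_expand_subset[of e xs] by (auto simp: expand_def sorted_wrt_append)
qed (simp add: expand_def)

lemma bij_betw_Ex1_iff:
  assumes "bij_betw F E X" "\<And>e. e \<in> E \<Longrightarrow> P e \<longleftrightarrow> Q (F e)"
  shows "(\<exists>!e. e \<in> E \<and> P e) \<longleftrightarrow> (\<exists>!x. x \<in> X \<and> Q x)"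
proof -
  have "X = F ` E" "inj_on F E"
    using assms(1) by (auto simp: bij_betw_def)
  then show ?thesis
    using assms(2) unfolding Ex1_def by (blast dest: inj_onD)
qed

context monoid
begin

lemma foldr_mult_closed:
  "y ` set xs \<subseteq> carrier G \<Longrightarrow> foldr (\<otimes>) (map y xs) \<one> \<in> carrier G"
  by (induction xs) auto

lemma foldr_mult_expand:
  assumes "y ` set xs \<subseteq> carrier G"
  shows "foldr (\<otimes>) (map y (expand e xs)) \<one> = foldr (\<otimes>) (map (\<lambda>i. y i [^] e i) xs) \<one>"
  using assms
proof (induction xs)
  case (Cons x xs)
  let ?z = "foldr (\<otimes>) (map (\<lambda>i. y i [^] e i) xs) \<one>"
  have "?z \<in> carrier G"
    using Cons.prems by (intro foldr_mult_closed) auto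
  then have "foldr (\<otimes>) (map y (replicate n x)) ?z = y x [^] n \<otimes> ?z" for n
  proof (induction n)
    case (Suc n)
    have "y x [^] Suc n = y x \<otimes> y x [^] n"
      using Cons.prems by (intro nat_pow_Suc2) auto
    then show ?case
      using Suc Cons.prems by (simp add: m_assoc del: nat_pow_Suc)
  qed auto
  then show ?case using Cons by (simp add: expand_def)
qed (simp add: expand_def)

text \<open>Expanding exponents and counting multiplicities are mutually inverse between finitely
  supported exponent functions on \<open>J\<close> and sorted lists over \<open>J\<close>, since a
  sorted list is determined by its multiset.\<close>

lemma complete_factorization_iff:
  "complete_factorization G J R y \<longleftrightarrow> linear_order_on J R \<and> y ` J \<subseteq> carrier G \<and>
    (\<forall>w \<in> carrier G. \<exists>!x. set x \<subseteq> J \<and> sorted_wrt (\<lambda>i j. (i, j) \<in> R) x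
      \<and> w = foldr (\<otimes>) (map y x) \<one>)"
proof (cases "linear_order_on J R \<and> y ` J \<subseteq> carrier G")
  case True
  let ?E = "{e. finite {i. e i \<noteq> 0} \<and> {i. e i \<noteq> 0} \<subseteq> J}"
  let ?X = "{x. set x \<subseteq> J \<and> sorted_wrt (\<lambda>i j. (i, j) \<in> R) x}"
  define F where "F e = expand e (ordered_support R e)" for e
  have R: "refl_on J R" "antisym R"
    using True by (auto simp: order_on_defs)
  have count_F: "count (mset (F e)) = e" and F_in: "F e \<in> ?X"
    and F_prod: "ordered_prod G R y e = foldr (\<otimes>) (map y (F e)) \<one>" if "e \<in> ?E" for e
  proof -
    have supp: "distinct (ordered_support R e)" "set (ordered_support R e) = {i. e i \<noteq> 0}"
      "sorted_wrt (\<lambda>i j. (i, j) \<in> R) (ordered_support R e)"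
      using ordered_support[of J R e] that True by auto
    show "count (mset (F e)) = e"
      using supp by (auto simp: F_def count_expand)
    show "F e \<in> ?X"
      using supp that R set_expand_subset[of e "ordered_support R e"]
      by (auto simp: F_def intro!: sorted_wrt_expand)
    show "ordered_prod G R y e = foldr (\<otimes>) (map y (F e)) \<one>"
      unfolding ordered_prod_def F_def using supp that True by (subst foldr_mult_expand) auto
  qed
  have count_in: "count (mset x) \<in> ?E" if "x \<in> ?X" for x
    using that by (auto simp: count_eq_zero_iff)
  have F_count: "F (count (mset x)) = x" if "x \<in> ?X" for x
    using sorted_wrt_mset_unique[OF R(2)] F_in[OF count_in[OF that]] count_F[OF count_in[OF that]] that
    by (simp add: count_inject)
  have bij: "bij_betw F ?E ?X"
    by (intro bij_betw_byWitness[of _ "\<lambda>x. count (mset x)"])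
      (use count_F F_in count_in F_count in auto)
  have "(\<exists>!e. e \<in> ?E \<and> w = ordered_prod G R y e) \<longleftrightarrow>
      (\<exists>!x. x \<in> ?X \<and> w = foldr (\<otimes>) (map y x) \<one>)" for w
    using F_prod by (intro bij_betw_Ex1_iff[OF bij]) auto
  then show ?thesis
    using True by (simp add: complete_factorization_def conj_assoc)
qed (auto simp: complete_factorization_def)

end

lemma foldr_mult_foliage:
  assumes "set x \<subseteq> free_magma A"
  shows "foldr (monoid.mult (trace_monoid A \<theta>)) (map (foliage A \<theta>) x) \<one>\<^bsub>trace_monoid A \<theta>\<^esub>
    = trace_cong A \<theta> `` {words x}"
  using assms
proof (induction x)
  case Nil
  then show ?case by (simp add: trace_monoid_def)
next
  case (Cons t x)
  then show ?case
    using set_words_free_magma[of x A]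
    by (simp add: foliage_eq_class trace_mult_class lists_eq_set leaves_free_magma)
qed

text \<open>Moves the whole question from the quotient to representative words, so that the later
  arguments only handle \<open>trace_cong\<close> on lists.\<close>

lemma complete_factorization_foliage_iff:
  assumes "H \<subseteq> free_magma A"
  shows "complete_factorization (trace_monoid A \<theta>) H (r\<inverse>) (foliage A \<theta>) \<longleftrightarrow>
    linear_order_on H r \<and>
    (\<forall>w. set w \<subseteq> A \<longrightarrow>
      (\<exists>!x. set x \<subseteq> H \<and> sorted_wrt (\<lambda>s t. (t, s) \<in> r) x \<and> (w, words x) \<in> trace_cong A \<theta>))"
proof -
  interpret monoid "trace_monoid A \<theta>"
    by (rule monoid_trace_monoid)
  have "trace_cong A \<theta> `` {w} = foldr (monoid.mult (trace_monoid A \<theta>)) (map (foliage A \<theta>) x) \<one>\<^bsub>trace_monoid A \<theta>\<^esub>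
      \<longleftrightarrow> (w, words x) \<in> trace_cong A \<theta>" if "set w \<subseteq> A" "set x \<subseteq> H" for w x
    using that assms set_words_free_magma[of x A]
    by (subst foldr_mult_foliage) (auto simp: trace_class_eq_iff)
  then have *: "(\<exists>!x. set x \<subseteq> H \<and> sorted_wrt (\<lambda>s t. (t, s) \<in> r) x \<and> (w, words x) \<in> trace_cong A \<theta>)
    \<longleftrightarrow> (\<exists>!x. set x \<subseteq> H \<and> sorted_wrt (\<lambda>s t. (t, s) \<in> r) x \<and> trace_cong A \<theta> `` {w} =
      foldr (monoid.mult (trace_monoid A \<theta>)) (map (foliage A \<theta>) x) \<one>\<^bsub>trace_monoid A \<theta>\<^esub>)"
    if "set w \<subseteq> A" for w
    using that by (intro arg_cong[where f = Ex1] ext) blast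
  have car: "carrier (trace_monoid A \<theta>) = (\<lambda>w. trace_cong A \<theta> `` {w}) ` {w. set w \<subseteq> A}"
    by (auto simp: trace_monoid_def quotient_def lists_eq_set)
  have "foliage A \<theta> ` H \<subseteq> carrier (trace_monoid A \<theta>)"
    using assms by (auto intro: foliage_in_carrier)
  then show ?thesis
    unfolding complete_factorization_iff by (simp add: car *)
qed

section \<open>Elimination of a vertex\<close>

text \<open>The vertex set of \<open>H_star\<close>, with nonadjacency to \<open>s\<close> expressed
  by leaves and the bound on leaves factored out of both alternatives.\<close>

definition star :: "'a set \<Rightarrow> ('a \<times> 'a) set \<Rightarrow> nat \<Rightarrow> 'a mtree \<Rightarrow> 'a mtree set \<Rightarrow> 'a mtree set" where
  "star A \<theta> n s V = {t \<in> free_magma_le A n. t \<in> V - {s} \<or>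
    (\<exists>z m. t = left_comb z s m \<and> m > 0 \<and> z \<in> V - {s} \<and> \<not> indep \<theta> z s)}"

text \<open>The condition that an elimination string imposes on its starting point.
  Contrapositively, the vertices that do not commute with \<open>s\<close> are pairwise
  noncommuting.\<close>

definition eliminable :: "('a \<times> 'a) set \<Rightarrow> 'a mtree \<Rightarrow> 'a mtree set \<Rightarrow> bool" where
  "eliminable \<theta> s V \<longleftrightarrow>
    (\<forall>z\<in>V - {s}. \<forall>z'\<in>V - {s}. indep \<theta> z z' \<longrightarrow> indep \<theta> z s \<or> indep \<theta> z' s)"

primrec elim_chain ::
    "'a set \<Rightarrow> ('a \<times> 'a) set \<Rightarrow> nat \<Rightarrow> 'a mtree list \<Rightarrow> 'a mtree set \<Rightarrow> bool" where
  "elim_chain A \<theta> n [] V \<longleftrightarrow> V = {}"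
| "elim_chain A \<theta> n (s # ss) V \<longleftrightarrow>
    s \<in> V \<and> eliminable \<theta> s V \<and> elim_chain A \<theta> n ss (star A \<theta> n s V)"

text \<open>Reading the word from right to left, every occurrence of \<open>s\<close> travels to the left until it
  meets a letter that does not commute with \<open>s\<close> and is absorbed there; the first component counts
  the occurrences that reach the left end.\<close>

primrec eliminate ::
    "('a \<times> 'a) set \<Rightarrow> 'a mtree \<Rightarrow> 'a mtree list \<Rightarrow> nat \<times> 'a mtree list" where
  "eliminate \<theta> s [] = (0, [])"
| "eliminate \<theta> s (z # u) = (case eliminate \<theta> s u of (k, y) \<Rightarrow>
    if z = s then (Suc k, y)
    else if indep \<theta> z s then (k, z # y)
    else (0, left_comb z s k # y))"

primrec normal_form :: "('a \<times> 'a) set \<Rightarrow> 'a mtree list \<Rightarrow> 'a mtree list \<Rightarrow> 'a mtree list" where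
  "normal_form \<theta> [] u = []"
| "normal_form \<theta> (s # ss) u =
    (case eliminate \<theta> s u of (k, y) \<Rightarrow> replicate k s @ normal_form \<theta> ss y)"

text \<open>Describes products of powers in the order of elimination without mentioning an order, so
  that it follows the recursion of \<open>normal_form\<close>; \<open>is_normal_form_iff\<close>
  supplies the order afterwards.\<close>

primrec is_normal_form :: "'a mtree list \<Rightarrow> 'a mtree list \<Rightarrow> bool" where
  "is_normal_form [] x \<longleftrightarrow> x = []"
| "is_normal_form (s # ss) x \<longleftrightarrow> (\<exists>k x'. x = replicate k s @ x' \<and> is_normal_form ss x')"

text \<open>Trees serve as letters of another trace monoid. Its alphabet is \<open>UNIV\<close>, so
  that one congruence works for all successive graphs; membership in the current vertex set is
  tracked separately.\<close>

abbreviation tree_cong :: "('a \<times> 'a) set \<Rightarrow> ('a mtree list \<times> 'a mtree list) set" where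
  "tree_cong \<theta> \<equiv> trace_cong UNIV {(s, t). indep \<theta> s t}"

abbreviation state_cong ::
    "('a \<times> 'a) set \<Rightarrow> nat \<times> 'a mtree list \<Rightarrow> nat \<times> 'a mtree list \<Rightarrow> bool" where
  "state_cong \<theta> \<equiv> rel_prod (=) (\<lambda>y y'. (y, y') \<in> tree_cong \<theta>)"

lemma state_cong_sym: "state_cong \<theta> p q \<Longrightarrow> state_cong \<theta> q p"
  by (cases p; cases q) (simp add: trace_cong.sym)

lemma state_cong_trans:
  assumes "state_cong \<theta> p q" "state_cong \<theta> q r"
  shows "state_cong \<theta> p r"
  using assms trace_cong.trans[of "snd p" "snd q" UNIV "{(s, t). indep \<theta> s t}" "snd r"]
  by (cases p; cases q; cases r) simp

section \<open>One elimination step: words, vertices, compatibility and surjectivity\<close>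

lemma word_left_comb: "word (left_comb z s k) = word z @ words (replicate k s)"
proof (induction k)
  case (Suc k)
  have "replicate (Suc k) s = replicate k s @ [s]"
    by (simp add: replicate_append_same)
  then show ?case
    using Suc by (simp del: replicate.simps)
qed simp

lemma left_comb_free_magma:
  "z \<in> free_magma A \<Longrightarrow> s \<in> free_magma A \<Longrightarrow> left_comb z s k \<in> free_magma A"
  by (induction k) auto

lemma indep_left_comb: "indep \<theta> t z \<Longrightarrow> indep \<theta> t s \<Longrightarrow> indep \<theta> t (left_comb z s k)"
  by (induction k) auto

lemma star_free_magma: "star A \<theta> n s V \<subseteq> free_magma A"
  by (auto simp: star_def free_magma_le_def)

text \<open>The only genuine rewriting is moving powers of \<open>s\<close> across a tree that
  commutes with \<open>s\<close>; absorbing them into a comb leaves the underlying word literally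
  unchanged.\<close>

lemma words_eliminate:
  assumes "set u \<subseteq> free_magma A" "s \<in> free_magma A" "eliminate \<theta> s u = (k, y)"
  shows "(words u, words (replicate k s) @ words y) \<in> trace_cong A \<theta> \<and> set y \<subseteq> free_magma A"
  using assms(1,3)
proof (induction u arbitrary: k y)
  case Nil
  then show ?case by (auto intro: trace_cong.refl)
next
  case (Cons z u)
  obtain l x where lx: "eliminate \<theta> s u = (l, x)"
    by fastforce
  have z: "z \<in> free_magma A" and
    IH: "(words u, words (replicate l s) @ words x) \<in> trace_cong A \<theta>" "set x \<subseteq> free_magma A"
    using Cons.IH[OF _ lx] Cons.prems(1) by auto
  have zu: "(word z @ words u, word z @ words (replicate l s) @ words x) \<in> trace_cong A \<theta>"
    using IH(1) z by (intro trace_cong.append trace_cong.refl) (auto simp: lists_eq_set dest: leaves_free_magma)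
  consider "z = s" | "z \<noteq> s" "indep \<theta> z s" | "z \<noteq> s" "\<not> indep \<theta> z s"
    by auto
  then show ?case
  proof cases
    case 1
    then show ?thesis using zu Cons.prems lx IH by auto
  next
    case 2
    have "((word z @ words (replicate l s)) @ words x, (words (replicate l s) @ word z) @ words x)
        \<in> trace_cong A \<theta>"
      using 2 z assms(2) IH(2) set_words_free_magma[OF IH(2)]
      by (intro trace_cong.append trace_cong.refl trace_cong_commute)
        (auto simp: lists_eq_set indep_def dest: leaves_free_magma)
    then show ?thesis
      using trace_cong.trans[OF zu] 2 Cons.prems lx IH z by auto
  next
    case 3
    then show ?thesis
      using zu Cons.prems lx IH z assms(2) left_comb_free_magma[of z A s l]
      by (auto simp: word_left_comb)
  qed
qed

lemma eliminate_subset: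
  assumes "set u \<subseteq> V" "eliminate \<theta> s u = (k, y)"
  shows "set y \<subseteq> V - {s} \<union> {left_comb z s m |z m. m > 0 \<and> z \<in> V - {s} \<and> \<not> indep \<theta> z s}"
proof -
  define S where
    "S = V - {s} \<union> {left_comb z s m |z m. m > 0 \<and> z \<in> V - {s} \<and> \<not> indep \<theta> z s}"
  have S: "z \<in> S" if "z \<in> V" "z \<noteq> s" for z
    using that by (auto simp: S_def)
  \<comment> \<open>A comb with no copy of \<open>s\<close> is \<open>z\<close> itself and belongs
    to the first part of \<open>S\<close>, hence the separate case.\<close>
  have S': "left_comb z s m \<in> S" if "z \<in> V" "z \<noteq> s" "\<not> indep \<theta> z s" for z m
  proof (cases "m = 0")
    case False
    then show ?thesis using that unfolding S_def by blast
  qed (use that S in auto)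
  have "set y \<subseteq> S"
    using assms
  proof (induction u arbitrary: k y)
    case (Cons z u)
    obtain l x where "eliminate \<theta> s u = (l, x)"
      by fastforce
    then show ?case
      using Cons S S' by (auto split: if_splits)
  qed auto
  then show ?thesis by (simp add: S_def)
qed

text \<open>The truncation loses nothing here: length is a trace invariant, so each tree that is
  produced has at most \<open>n\<close> leaves.\<close>

lemma eliminate_star:
  assumes "set u \<subseteq> V" "V \<subseteq> free_magma A" "s \<in> V" "length (words u) \<le> n"
    "eliminate \<theta> s u = (k, y)"
  shows "set y \<subseteq> star A \<theta> n s V" "length (words y) \<le> n"
proof -
  have W: "(words u, words (replicate k s) @ words y) \<in> trace_cong A \<theta>" "set y \<subseteq> free_magma A"
    using words_eliminate[OF _ _ assms(5), of A] assms by auto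
  show n: "length (words y) \<le> n"
    using trace_cong_length[OF W(1)] assms(4) by simp
  show "set y \<subseteq> star A \<theta> n s V"
  proof
    fix t assume t: "t \<in> set y"
    then have "t \<in> free_magma_le A n"
      using W(2) n num_leaves_le_words[OF t] by (auto simp: free_magma_le_def)
    moreover have "t \<in> V - {s} \<or>
        (\<exists>z m. t = left_comb z s m \<and> m > 0 \<and> z \<in> V - {s} \<and> \<not> indep \<theta> z s)"
      using subsetD[OF eliminate_subset[OF assms(1,5)] t] by simp
    ultimately show "t \<in> star A \<theta> n s V"
      unfolding star_def by auto
  qed
qed

text \<open>The scan runs from right to left, so a prefix acts on the state left by the rest. It
  changes the exponent and puts trees in front, but never inspects the remaining list.\<close>

lemma eliminate_append_cong:
  assumes "state_cong \<theta> (eliminate \<theta> s v) (eliminate \<theta> s v')"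
  shows "state_cong \<theta> (eliminate \<theta> s (u @ v)) (eliminate \<theta> s (u @ v'))"
  using assms
proof (induction u)
  case (Cons z u)
  then show ?case by (auto split: prod.splits simp: rel_prod_conv intro: trace_cong_Cons)
qed auto

text \<open>Of two commuting vertices different from \<open>s\<close> at most one absorbs occurrences of \<open>s\<close>, and the
  resulting comb still commutes with the other one.\<close>

lemma eliminate_swap:
  assumes "sym \<theta>" "eliminable \<theta> s V" "a \<in> V" "b \<in> V" "indep \<theta> a b"
  shows "state_cong \<theta>
    (eliminate \<theta> s (a # b # w)) (eliminate \<theta> s (b # a # w))"
proof -
  obtain k y where ky: "eliminate \<theta> s w = (k, y)"
    by fastforce
  have refl: "(v, v) \<in> tree_cong \<theta>" for v
    by (simp add: trace_cong.refl)
  have swap: "(c # d # v, d # c # v) \<in> tree_cong \<theta>" if "indep \<theta> c d" for c d v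
    using trace_cong.append[OF trace_cong.swap[of c d "{(s, t). indep \<theta> s t}" UNIV] refl[of v]] that
    by simp
  have *: "indep \<theta> b a" "a \<noteq> s \<Longrightarrow> b \<noteq> s \<Longrightarrow> indep \<theta> a s \<or> indep \<theta> b s"
    using assms by (auto simp: eliminable_def intro: indep_sym)
  have comb: "indep \<theta> a (left_comb b s k)" if "indep \<theta> a s"
    using that assms(5) by (rule indep_left_comb[rotated])
  have comb': "indep \<theta> (left_comb a s k) b" if "indep \<theta> b s"
    using indep_sym[OF assms(1) indep_left_comb[OF *(1)]] that by simp
  show ?thesis
    using * assms(5) ky
    by (cases "a = s"; cases "b = s"; cases "indep \<theta> a s"; cases "indep \<theta> b s")
      (simp_all add: swap refl comb comb')
qed

text \<open>The suffix \<open>w\<close> is arbitrary because of the direction of the scan: in a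
  concatenation the left part meets the state produced by everything to its right, so its induction
  hypothesis is applied with a longer suffix.\<close>

lemma eliminate_cong:
  assumes "sym \<theta>" "eliminable \<theta> s V" "(u, u') \<in> tree_cong \<theta>" "set u \<subseteq> V"
  shows "state_cong \<theta>
    (eliminate \<theta> s (u @ w)) (eliminate \<theta> s (u' @ w))"
  using assms(3,4)
proof (induction arbitrary: w)
  case (swap a b)
  then show ?case using eliminate_swap[OF assms(1,2), of a b w] by auto
next
  case (refl u)
  then show ?case by (cases "eliminate \<theta> s (u @ w)") (auto intro: trace_cong.refl)
next
  case (sym u v)
  then have "state_cong \<theta> (eliminate \<theta> s (u @ w)) (eliminate \<theta> s (v @ w))"
    using trace_cong_set[OF sym.hyps] by simp
  then show ?case by (rule state_cong_sym)
next
  case (trans u v x)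
  have "state_cong \<theta> (eliminate \<theta> s (u @ w)) (eliminate \<theta> s (v @ w))"
    "state_cong \<theta> (eliminate \<theta> s (v @ w)) (eliminate \<theta> s (x @ w))"
    using trans trace_cong_set[OF trans.hyps(1)] by auto
  then show ?case by (rule state_cong_trans)
next
  case (append u u' v v')
  have "state_cong \<theta>
      (eliminate \<theta> s (u @ v @ w)) (eliminate \<theta> s (u' @ v @ w))"
    using append by auto
  moreover have "state_cong \<theta>
      (eliminate \<theta> s (u' @ v @ w)) (eliminate \<theta> s (u' @ v' @ w))"
    using append by (intro eliminate_append_cong) auto
  ultimately show ?case
    by (simp add: state_cong_trans)
qed

lemma eliminate_replicate:
  "eliminate \<theta> s u = (k, y) \<Longrightarrow> eliminate \<theta> s (replicate m s @ u) = (m + k, y)"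
  by (induction m) auto

lemma eliminate_surj:
  assumes "s \<in> V" "set y \<subseteq> star A \<theta> n s V"
  shows "\<exists>u. set u \<subseteq> V \<and> eliminate \<theta> s u = (k, y) \<and> words u = words (replicate k s) @ words y"
  using assms(2)
proof (induction y arbitrary: k)
  case Nil
  show ?case
    using eliminate_replicate[of \<theta> s "[]" 0 "[]" k] assms(1)
    by (intro exI[of _ "replicate k s"]) auto
next
  case (Cons t y)
  have t: "t \<in> star A \<theta> n s V"
    using Cons.prems by auto
  obtain z m where z: "t = left_comb z s m" "z \<in> V" "z \<noteq> s" "m = 0 \<or> \<not> indep \<theta> z s"
  proof (cases "t \<in> V - {s}")
    case True
    then show ?thesis using that[of t 0] by auto
  next
    case False
    then show ?thesis using t that unfolding star_def by auto
  qed
  \<comment> \<open>The induction hypothesis is taken with exponent \<open>m\<close>: the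
    \<open>m\<close> free copies of \<open>s\<close> in front of \<open>y\<close> are exactly those
    that \<open>z\<close> absorbs to become \<open>t\<close>. The \<open>k\<close> copies placed
    before \<open>z\<close> then stay free.\<close>
  obtain u where u: "set u \<subseteq> V" "eliminate \<theta> s u = (m, y)"
    "words u = words (replicate m s) @ words y"
    using Cons.IH[of m] Cons.prems by auto
  have "eliminate \<theta> s (z # u) = (0, t # y)"
    using z u by auto
  then have "eliminate \<theta> s (replicate k s @ z # u) = (k, t # y)"
    using eliminate_replicate[of \<theta> s "z # u" 0 "t # y" k] by simp
  then show ?case
    using z u assms(1) word_left_comb[of z s m]
    by (intro exI[of _ "replicate k s @ z # u"]) auto
qed

section \<open>Normal forms along a chain of eliminations\<close>

lemma normal_form_cong:
  assumes "sym \<theta>" "elim_chain A \<theta> n ss V" "V \<subseteq> free_magma A"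
    "(u, u') \<in> tree_cong \<theta>" "set u \<subseteq> V" "length (words u) \<le> n"
  shows "normal_form \<theta> ss u = normal_form \<theta> ss u'"
  using assms(2-)
proof (induction ss arbitrary: V u u')
  case (Cons s ss)
  obtain k y k' y' where ky: "eliminate \<theta> s u = (k, y)" "eliminate \<theta> s u' = (k', y')"
    by fastforce
  have "k = k'" and y: "(y, y') \<in> tree_cong \<theta>"
    using eliminate_cong[OF assms(1) _ Cons.prems(3,4), of s "[]"] ky Cons.prems(1) by auto
  moreover have "normal_form \<theta> ss y = normal_form \<theta> ss y'"
    using Cons.prems ky y eliminate_star[of u V A s n \<theta> k y]
      star_free_magma[of A \<theta> n s V]
    by (intro Cons.IH[of "star A \<theta> n s V"]) auto
  ultimately show ?case using ky by simp
qed simp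

lemma normal_form:
  assumes "elim_chain A \<theta> n ss V" "V \<subseteq> free_magma A" "set u \<subseteq> V" "length (words u) \<le> n"
  shows "(words u, words (normal_form \<theta> ss u)) \<in> trace_cong A \<theta> \<and> is_normal_form ss (normal_form \<theta> ss u)"
  using assms
proof (induction ss arbitrary: V u)
  case Nil
  then show ?case by (auto intro: trace_cong.refl)
next
  case (Cons s ss)
  obtain k y where ky: "eliminate \<theta> s u = (k, y)"
    by fastforce
  have s: "s \<in> V" "s \<in> free_magma A" using Cons.prems by auto
  have W: "(words u, words (replicate k s) @ words y) \<in> trace_cong A \<theta>"
    using words_eliminate[OF _ s(2) ky] Cons.prems by auto
  have IH: "(words y, words (normal_form \<theta> ss y)) \<in> trace_cong A \<theta>" "is_normal_form ss (normal_form \<theta> ss y)"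
    using Cons.IH[of "star A \<theta> n s V" y] Cons.prems ky s eliminate_star[of u V A s n \<theta> k y]
      star_free_magma[of A \<theta> n s V]
    by auto
  have "(words (replicate k s) @ words y, words (replicate k s) @ words (normal_form \<theta> ss y))
      \<in> trace_cong A \<theta>"
    using IH(1) s set_words_free_magma[of "replicate k s" A]
    by (intro trace_cong.append trace_cong.refl) (auto simp: lists_eq_set dest: leaves_free_magma)
  then show ?case
    using trace_cong.trans[OF W] IH(2) ky by auto
qed

text \<open>Unfolding each comb into its base followed by copies of \<open>s\<close> preserves the
  underlying word exactly, not merely up to congruence. When the vertices are letters,
  \<open>u\<close> is therefore the word of \<open>x\<close> itself, which yields
  uniqueness.\<close>

lemma normal_form_surj:
  assumes "elim_chain A \<theta> n ss V" "is_normal_form ss x"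
  shows "\<exists>u. set u \<subseteq> V \<and> normal_form \<theta> ss u = x \<and> words u = words x"
  using assms
proof (induction ss arbitrary: V x)
  case Nil
  then show ?case by (intro exI[of _ "[]"]) auto
next
  case (Cons s ss)
  then obtain k x' where x: "x = replicate k s @ x'" "is_normal_form ss x'"
    by auto
  obtain y where y: "set y \<subseteq> star A \<theta> n s V" "normal_form \<theta> ss y = x'" "words y = words x'"
    using Cons.IH[OF _ x(2)] Cons.prems by auto
  obtain u where "set u \<subseteq> V" "eliminate \<theta> s u = (k, y)" "words u = words (replicate k s) @ words y"
    using eliminate_surj[OF _ y(1)] Cons.prems by auto
  then show ?case using x y by (intro exI[of _ u]) auto
qed

lemma words_map_Letter [simp]: "concat (map (word \<circ> Letter) w) = w"
  by (induction w) auto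

lemma trace_cong_map_Letter:
  "(u, v) \<in> trace_cong A \<theta> \<Longrightarrow> (map Letter u, map Letter v) \<in> tree_cong \<theta>"
proof (induction rule: trace_cong.induct)
  case (swap a b)
  then show ?case by (auto intro!: trace_cong.swap simp: indep_def)
qed (simp_all add: trace_cong.intros(2-3,5), blast intro: trace_cong.trans)

lemma elim_chain_factorization:
  assumes "sym \<theta>" "elim_chain A \<theta> n ss (Letter ` A)" "set w \<subseteq> A" "length w \<le> n"
  shows "\<exists>!x. is_normal_form ss x \<and> (w, words x) \<in> trace_cong A \<theta>"
proof -
  let ?N = "\<lambda>w. normal_form \<theta> ss (map Letter w)"
  have A: "Letter ` A \<subseteq> free_magma A"
    by auto
  have cong: "?N w = ?N w'" if "(w, w') \<in> trace_cong A \<theta>" for w'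
    using normal_form_cong[OF assms(1,2) A trace_cong_map_Letter[OF that]] assms(3,4) by auto
  \<comment> \<open>A list of letters is determined by its word, so \<open>x\<close> is the normal
    form of \<open>words x\<close>; this word is congruent to \<open>w\<close>, and congruent words
    share their normal form.\<close>
  have "x = ?N w" if "is_normal_form ss x" "(w, words x) \<in> trace_cong A \<theta>" for x
  proof -
    note nf = that
    obtain u where u: "set u \<subseteq> Letter ` A" "normal_form \<theta> ss u = x" "words u = words x"
      using normal_form_surj[OF assms(2) nf(1)] by auto
    then obtain w' where "u = map Letter w'"
      by (metis ex_map_conv image_iff subset_code(1))
    then show ?thesis
      using u cong[OF nf(2)] by simp
  qed
  moreover have "is_normal_form ss (?N w) \<and> (w, words (?N w)) \<in> trace_cong A \<theta>"
    using normal_form[OF assms(2) A, of "map Letter w"] assms(3,4) by auto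
  ultimately show ?thesis by blast
qed

lemma is_normal_form_iff:
  assumes "refl_on (set ss) R" "antisym R" "sorted_wrt (\<lambda>s t. (s, t) \<in> R) ss" "distinct ss"
  shows "is_normal_form ss x \<longleftrightarrow> set x \<subseteq> set ss \<and> sorted_wrt (\<lambda>s t. (s, t) \<in> R) x"
  using assms(1,3,4)
proof (induction ss arbitrary: x)
  case (Cons s ss)
  have refl: "refl_on (set ss) R" "(s, s) \<in> R"
    using Cons.prems(1) by (auto simp: refl_on_def)
  have IH: "is_normal_form ss y \<longleftrightarrow> set y \<subseteq> set ss \<and> sorted_wrt (\<lambda>s t. (s, t) \<in> R) y" for y
    using Cons refl by auto
  have sorted_replicate: "sorted_wrt (\<lambda>s t. (s, t) \<in> R) (replicate k s)" for k
    using refl(2) by (induction k) auto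
  show ?case
  proof
    assume "is_normal_form (s # ss) x"
    then obtain k y where "x = replicate k s @ y" "is_normal_form ss y"
      by auto
    then show "set x \<subseteq> set (s # ss) \<and> sorted_wrt (\<lambda>s t. (s, t) \<in> R) x"
      using IH[of y] Cons.prems(2) sorted_replicate by (auto simp: sorted_wrt_append)
  next
    assume x: "set x \<subseteq> set (s # ss) \<and> sorted_wrt (\<lambda>s t. (s, t) \<in> R) x"
    then show "is_normal_form (s # ss) x"
    proof (induction x)
      case Nil
      show ?case using IH[of "[]"] by (auto intro: exI[of _ 0])
    next
      case (Cons t x)
      show ?case
      proof (cases "t = s")
        case True
        obtain k y where "x = replicate k s @ y" "is_normal_form ss y"
          using Cons by auto
        then show ?thesis
          using True by (auto intro!: exI[of _ "Suc k"])
      next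
        case False
        \<comment> \<open>\<open>s\<close> is the \<open>R\<close>-least entry, so a sorted list
          that starts with another entry contains no \<open>s\<close>; the exponent of
          \<open>s\<close> is 0.\<close>
        have "s \<notin> set x"
          using Cons.prems \<open>sorted_wrt (\<lambda>s t. (s, t) \<in> R) (s # ss)\<close> False assms(2)
          by (auto dest: antisymD)
        then have "is_normal_form ss (t # x)"
          using IH[of "t # x"] Cons.prems False by auto
        then show ?thesis by (auto intro!: exI[of _ 0])
      qed
    qed
  qed
qed auto

section \<open>Lazard runs and the Hall conditions in bounded degree\<close>

lemma free_magma_le_Br:
  "Br s t \<in> free_magma_le A n \<Longrightarrow> s \<in> free_magma_le A n \<and> t \<in> free_magma_le A n"
  by (auto simp: free_magma_le_def)

lemma finite_free_magma_le:
  assumes "finite A"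
  shows "finite (free_magma_le A n)"
proof (induction n)
  case 0
  have "free_magma_le A 0 = {}"
    by (auto simp: free_magma_le_def)
  then show ?case by simp
next
  case (Suc n)
  have "t \<in> Letter ` A \<union> (\<lambda>(s, t). Br s t) ` (free_magma_le A n \<times> free_magma_le A n)"
    if "t \<in> free_magma_le A (Suc n)" for t
  proof (cases t)
    case (Br x y)
    then show ?thesis
      using that num_leaves_pos[of x] num_leaves_pos[of y]
      by (auto simp: free_magma_le_def image_iff simp del: num_leaves_pos)
  qed (use that in \<open>auto simp: free_magma_le_def\<close>)
  then have "free_magma_le A (Suc n) \<subseteq>
      Letter ` A \<union> (\<lambda>(s, t). Br s t) ` (free_magma_le A n \<times> free_magma_le A n)"
    by blast
  then show ?case
    using assms Suc by (auto intro: finite_subset)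
qed

text \<open>The Hall conditions apart from the factorization. The set \<open>U\<close> limits the
  trees whose membership is characterized, so that the same predicate covers the whole free magma
  and its truncations.\<close>

definition hall_rules ::
    "'a set \<Rightarrow> ('a \<times> 'a) set \<Rightarrow> 'a mtree set \<Rightarrow> 'a mtree set \<Rightarrow> ('a mtree \<times> 'a mtree) set \<Rightarrow> bool" where
  "hall_rules A \<theta> U H r \<longleftrightarrow> Letter ` A \<subseteq> H \<and>
    (\<forall>h' h''. Br h' h'' \<in> H \<longrightarrow> h'' \<in> H \<and> (Br h' h'', h'') \<in> r \<and> Br h' h'' \<noteq> h'') \<and>
    (\<forall>h' h''. Br h' h'' \<in> U \<longrightarrow>
      (Br h' h'' \<in> H \<longleftrightarrow> h' \<in> H \<and> h'' \<in> H \<and> (h', h'') \<in> r \<and> h' \<noteq> h'' \<and> \<not> indep \<theta> h' h'' \<and>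
        (h' \<in> Letter ` A \<or> (\<exists>x y. h' = Br x y \<and> (h'', y) \<in> r))))"

lemma hall_rulesD:
  assumes "hall_rules A \<theta> U H r"
  shows "Letter ` A \<subseteq> H"
    "Br x y \<in> H \<Longrightarrow> y \<in> H \<and> (Br x y, y) \<in> r \<and> Br x y \<noteq> y"
    "Br x y \<in> U \<Longrightarrow> Br x y \<in> H \<longleftrightarrow> x \<in> H \<and> y \<in> H \<and> (x, y) \<in> r \<and> x \<noteq> y \<and> \<not> indep \<theta> x y \<and>
      (x \<in> Letter ` A \<or> (\<exists>x' y'. x = Br x' y' \<and> (y, y') \<in> r))"
  using assms unfolding hall_rules_def by simp_all

lemma hall_rulesI:
  assumes "Letter ` A \<subseteq> H"
    "\<And>x y. Br x y \<in> H \<Longrightarrow> y \<in> H \<and> (Br x y, y) \<in> r \<and> Br x y \<noteq> y"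
    "\<And>x y. Br x y \<in> U \<Longrightarrow> Br x y \<in> H \<longleftrightarrow> x \<in> H \<and> y \<in> H \<and> (x, y) \<in> r \<and> x \<noteq> y \<and> \<not> indep \<theta> x y \<and>
      (x \<in> Letter ` A \<or> (\<exists>x' y'. x = Br x' y' \<and> (y, y') \<in> r))"
  shows "hall_rules A \<theta> U H r"
  using assms unfolding hall_rules_def by simp

text \<open>The rules for a tree only compare subtrees of it, and truncations are closed under
  subtrees. Hence only the values of the order on \<open>X\<close> matter. This serves both
  directions: to truncate a Hall set, and to pass from an enumeration of high degree to the limit
  order.\<close>

lemma hall_rules_restrict:
  assumes "hall_rules A \<theta> U H r" "free_magma_le A n \<subseteq> U" "n > 0" "X = H \<inter> free_magma_le A n"
    "\<And>s t. s \<in> X \<Longrightarrow> t \<in> X \<Longrightarrow> (s, t) \<in> r' \<longleftrightarrow> (s, t) \<in> r"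
  shows "hall_rules A \<theta> (free_magma_le A n) X r'"
proof (rule hall_rulesI)
  note H = hall_rulesD[OF assms(1)]
  show "Letter ` A \<subseteq> X"
    using H(1) assms(3,4) by (auto simp: free_magma_le_def)
  show right: "y \<in> X \<and> (Br x y, y) \<in> r' \<and> Br x y \<noteq> y" if "Br x y \<in> X" for x y
  proof -
    have "y \<in> X"
      using that H(2)[of x y] free_magma_le_Br[of x y A n] assms(4) by simp
    then show ?thesis
      using that H(2)[of x y] assms(4) assms(5)[of "Br x y" y] by simp
  qed
  fix x y assume U: "Br x y \<in> free_magma_le A n"
  have le: "x \<in> free_magma_le A n" "y \<in> free_magma_le A n"
    using free_magma_le_Br[OF U] by auto
  \<comment> \<open>The right factor of \<open>x\<close> is again in \<open>X\<close>, so
    \<open>r\<close> and \<open>r'\<close> agree on the comparison with it.\<close>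
  have "(x \<in> Letter ` A \<or> (\<exists>x' y'. x = Br x' y' \<and> (y, y') \<in> r')) \<longleftrightarrow>
      (x \<in> Letter ` A \<or> (\<exists>x' y'. x = Br x' y' \<and> (y, y') \<in> r))" if "x \<in> X" "y \<in> X"
  proof (cases x)
    case (Br x' y')
    then show ?thesis
      using that right[of x' y'] assms(5)[of y y'] by simp
  qed simp
  then show "Br x y \<in> X \<longleftrightarrow> x \<in> X \<and> y \<in> X \<and> (x, y) \<in> r' \<and> x \<noteq> y \<and> \<not> indep \<theta> x y \<and>
      (x \<in> Letter ` A \<or> (\<exists>x' y'. x = Br x' y' \<and> (y, y') \<in> r'))"
    using H(3)[OF subsetD[OF assms(2) U]] U le assms(4) assms(5)[of x y] by auto
qed

text \<open>Only the vertex sets of a Lazard enumeration; the elimination condition is kept apart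
  because it belongs to the factorization rather than to the Hall rules.\<close>

definition lazard_run ::
    "'a set \<Rightarrow> ('a \<times> 'a) set \<Rightarrow> nat \<Rightarrow> 'a mtree list \<Rightarrow> (nat \<Rightarrow> 'a mtree set) \<Rightarrow> bool" where
  "lazard_run A \<theta> n ss V \<longleftrightarrow> V 0 = Letter ` A \<and> V (length ss) = {} \<and>
    (\<forall>i < length ss. ss ! i \<in> V i \<and> V (Suc i) = star A \<theta> n (ss ! i) (V i))"

text \<open>The vertices of the \<open>i\<close>-th graph of a run along \<open>ss\<close>: the trees not yet eliminated whose right
  factor has been eliminated.\<close>

definition active :: "'a mtree list \<Rightarrow> nat \<Rightarrow> 'a mtree set" where
  "active ss i = {t \<in> set (drop i ss). \<forall>x y. t = Br x y \<longrightarrow> y \<in> set (take i ss)}"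

text \<open>Later elements of the list are smaller, since the greatest tree is eliminated first.\<close>

definition list_order :: "'i list \<Rightarrow> ('i \<times> 'i) set" where
  "list_order ss = {(ss ! j, ss ! i) |i j. i \<le> j \<and> j < length ss}"

section \<open>Positions in a list without repetitions and the order that they induce\<close>

lemma nth_in_take_iff:
  assumes "distinct ss" "i < length ss"
  shows "ss ! i \<in> set (take k ss) \<longleftrightarrow> i < k"
  using assms by (auto simp: in_set_conv_nth nth_eq_iff_index_eq)

lemma nth_in_drop_iff:
  assumes "distinct ss" "i < length ss"
  shows "ss ! i \<in> set (drop k ss) \<longleftrightarrow> k \<le> i"
proof
  assume "k \<le> i"
  then have "drop k ss ! (i - k) = ss ! i" "i - k < length (drop k ss)"
    using assms by auto
  then show "ss ! i \<in> set (drop k ss)"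
    by (metis nth_mem)
next
  assume "ss ! i \<in> set (drop k ss)"
  then show "k \<le> i"
    using assms by (auto simp: in_set_conv_nth nth_eq_iff_index_eq)
qed

lemma in_set_drop_nth:
  assumes "distinct ss" "t \<in> set (drop k ss)"
  obtains i where "k \<le> i" "i < length ss" "t = ss ! i"
proof -
  obtain i where "i < length ss" "t = ss ! i"
    using in_set_dropD[OF assms(2)] unfolding in_set_conv_nth by blast
  then show thesis
    using that assms nth_in_drop_iff[OF assms(1), of i k] by simp
qed

lemma list_order_nth_iff:
  assumes "distinct ss" "i < length ss" "j < length ss"
  shows "(ss ! j, ss ! i) \<in> list_order ss \<longleftrightarrow> i \<le> j"
  using assms by (auto simp: list_order_def nth_eq_iff_index_eq)

lemma list_order_sorted:
  assumes "linear_order_on H r" "set ss \<subseteq> H" "distinct ss" "sorted_wrt (\<lambda>s t. (t, s) \<in> r) ss"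
    "s \<in> set ss" "t \<in> set ss"
  shows "(s, t) \<in> list_order ss \<longleftrightarrow> (s, t) \<in> r"
proof -
  obtain i j where ij: "i < length ss" "j < length ss" "s = ss ! j" "t = ss ! i"
    using assms(5,6) by (metis in_set_conv_nth)
  have r: "refl_on H r" "antisym r"
    using assms(1) by (auto simp: order_on_defs)
  have "(ss ! k, ss ! l) \<in> r" if "l < k" "k < length ss" for k l
    using sorted_wrt_nth_less[OF assms(4) that] .
  moreover have "(ss ! i, ss ! i) \<in> r"
    using r(1) assms(2,6) ij(4) by (auto simp: refl_on_def)
  ultimately have "i \<le> j \<longleftrightarrow> (ss ! j, ss ! i) \<in> r"
    using ij r(2) nth_eq_iff_index_eq[OF assms(3), of i j]
    by (cases i j rule: linorder_cases) (auto dest: antisymD)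
  then show ?thesis
    using list_order_nth_iff[OF assms(3) ij(1,2)] ij by simp
qed

lemma linear_order_list_order:
  assumes "distinct ss"
  shows "linear_order_on (set ss) (list_order ss)"
  unfolding order_on_defs
proof (intro conjI)
  show "list_order ss \<subseteq> set ss \<times> set ss"
    by (auto simp: list_order_def)
  show "refl_on (set ss) (list_order ss)"
  proof (rule refl_onI)
    fix x assume "x \<in> set ss"
    then obtain i where "i < length ss" "x = ss ! i"
      by (metis in_set_conv_nth)
    then show "(x, x) \<in> list_order ss"
      unfolding list_order_def by blast
  qed
  show "antisym (list_order ss)"
    using assms by (auto simp: list_order_def nth_eq_iff_index_eq intro!: antisymI)
  show "trans (list_order ss)"
  proof (rule transI)
    fix x y z assume "(x, y) \<in> list_order ss" "(y, z) \<in> list_order ss"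
    then obtain i j k l where ijkl: "i \<le> j" "j < length ss" "x = ss ! j" "y = ss ! i"
      "k \<le> l" "l < length ss" "y = ss ! l" "z = ss ! k"
      unfolding list_order_def by blast
    then have "l = i"
      using nth_eq_iff_index_eq[OF assms, of l i] by simp
    then show "(x, z) \<in> list_order ss"
      using ijkl list_order_nth_iff[OF assms, of k j] by simp
  qed
  show "total_on (set ss) (list_order ss)"
  proof (rule total_onI)
    fix x y assume "x \<in> set ss" "y \<in> set ss"
    then obtain i j where "i < length ss" "x = ss ! i" "j < length ss" "y = ss ! j"
      by (metis in_set_conv_nth)
    then show "(x, y) \<in> list_order ss \<or> (y, x) \<in> list_order ss"
      using list_order_nth_iff[OF assms, of i j] list_order_nth_iff[OF assms, of j i] by auto
  qed
qed

section \<open>Equivalence of Lazard runs and truncated Hall rules\<close>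

lemma star_iff:
  "t \<in> star A \<theta> n s V \<longleftrightarrow> t \<in> free_magma_le A n \<and> (t \<in> V - {s} \<or>
    (\<exists>z m. t = left_comb z s m \<and> m > 0 \<and> z \<in> V - {s} \<and> \<not> indep \<theta> z s))"
  by (simp add: star_def)

lemma left_comb_pos: "m > 0 \<Longrightarrow> left_comb z s m = Br (left_comb z s (m - 1)) s"
  by (cases m) auto

lemma not_indep_left_comb:
  assumes "irrefl \<theta>" "\<not> indep \<theta> z s"
  shows "\<not> indep \<theta> (left_comb z s m) s"
  using assms not_indep_self[OF assms(1)] by (cases m) auto

lemma lazard_run_active:
  assumes "n > 0" "distinct ss" "lazard_run A \<theta> n ss V" "i \<le> length ss"
  shows "V i = active ss i"
proof -
  have V: "V 0 = Letter ` A" "V (length ss) = {}"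
    "ss ! i \<in> V i" "V (Suc i) = star A \<theta> n (ss ! i) (V i)" if "i < length ss" for i
    using assms(3) that by (auto simp: lazard_run_def)
  have Vle: "V i \<subseteq> free_magma_le A n" if "i \<le> length ss" for i
    using that V assms(1,3)
    by (cases i) (auto simp: star_def free_magma_le_def lazard_run_def)
  \<comment> \<open>Backward induction from the empty last graph. All vertices already have at most
    \<open>n\<close> leaves, so a vertex can disappear only by being eliminated.\<close>
  have drop: "V i \<subseteq> set (drop i ss)" if "i \<le> length ss" for i
    using that
  proof (induction rule: inc_induct)
    case base
    then show ?case using assms(3) by (simp add: lazard_run_def)
  next
    case (step i)
    have "V i \<subseteq> insert (ss ! i) (V (Suc i))"
      using V(4)[OF step(2)] Vle[of i] step(2) by (auto simp: star_def)
    then show ?case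
      using step by (auto simp: Cons_nth_drop_Suc[symmetric])
  qed
  \<comment> \<open>Forward induction: a tree created by eliminating \<open>ss ! i\<close> has
    \<open>ss ! i\<close> as its right factor, and every other vertex is inherited.\<close>
  have take: "y \<in> set (take i ss)" if "i \<le> length ss" "Br x y \<in> V i" for i x y
    using that
  proof (induction i)
    case 0
    then show ?case using assms(3) by (auto simp: lazard_run_def)
  next
    case (Suc i)
    then have "Br x y \<in> star A \<theta> n (ss ! i) (V i)"
      using V(4)[of i] by simp
    then have "Br x y \<in> V i \<or> y = ss ! i"
      using left_comb_pos[of _ _ "ss ! i"] unfolding star_iff by auto
    then show ?case
      using Suc by (auto simp: take_Suc_conv_app_nth)
  qed
  have "t \<in> V i" if t: "t \<in> active ss i" for t
  proof -
    obtain j where j: "i \<le> j" "j < length ss" "t = ss ! j"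
      using t in_set_drop_nth[OF assms(2)] unfolding active_def by blast
    \<comment> \<open>Backward from position \<open>j\<close>, where \<open>t\<close> is eliminated
      and hence present. Step \<open>k\<close> cannot have created \<open>t\<close>, whose right
      factor already lies among the first \<open>k\<close> entries, so \<open>t\<close> was present
      before it.\<close>
    show ?thesis
      using j(1) t
    proof (induction rule: inc_induct)
      case base
      then show ?case using V(3)[OF j(2)] j by simp
    next
      case (step k)
      then have k: "k < length ss" using j by auto
      have "set (take k ss) \<subseteq> set (take (Suc k) ss)"
        by (rule set_take_subset_set_take) simp
      moreover have "t \<in> set (drop (Suc k) ss)"
        using step(2) j nth_in_drop_iff[OF assms(2) j(2), of "Suc k"] by simp
      ultimately have "t \<in> active ss (Suc k)"
        using step(4) by (auto simp: active_def)
      then have "t \<in> star A \<theta> n (ss ! k) (V k)"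
        using step.IH V(4)[OF k] by simp
      moreover have "ss ! k \<notin> set (take k ss)"
        using nth_in_take_iff[OF assms(2) k] by simp
      ultimately show ?case
        using step(4) left_comb_pos[of _ _ "ss ! k"] unfolding star_iff active_def by blast
    qed
  qed
  moreover have "t \<in> active ss i" if "t \<in> V i" for t
    using that drop[OF assms(4)] take[OF assms(4)] unfolding active_def by blast
  ultimately show ?thesis
    by blast
qed

lemma lazard_run_hall_rules:
  assumes "irrefl \<theta>" "n > 0" "distinct ss" "set ss \<subseteq> free_magma_le A n" "lazard_run A \<theta> n ss V"
  shows "hall_rules A \<theta> (free_magma_le A n) (set ss) (list_order ss)"
proof -
  note nth_take = nth_in_take_iff[OF assms(3)] and nth_drop = nth_in_drop_iff[OF assms(3)]
    and ord = list_order_nth_iff[OF assms(3)]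
  have in_active: "ss ! i \<in> active ss i"
    and step: "active ss (Suc i) = star A \<theta> n (ss ! i) (active ss i)" if "i < length ss" for i
    using assms(5) lazard_run_active[OF assms(2,3,5)] that by (auto simp: lazard_run_def)
  have "active ss 0 = Letter ` A"
    using assms(5) lazard_run_active[OF assms(2,3,5), of 0] by (auto simp: lazard_run_def)
  then have 1: "Letter ` A \<subseteq> set ss"
    by (auto simp: active_def)
  have right: "\<exists>j l. l < j \<and> j < length ss \<and> Br x y = ss ! j \<and> y = ss ! l" if "Br x y \<in> set ss" for x y
  proof -
    obtain j where j: "j < length ss" "Br x y = ss ! j"
      using \<open>Br x y \<in> set ss\<close> by (metis in_set_conv_nth)
    then have "y \<in> set (take j ss)"
      using in_active[OF j(1)] unfolding j(2)[symmetric] by (simp add: active_def)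
    then obtain l where "l < j" "y = ss ! l"
      by (auto simp: in_set_conv_nth)
    then show ?thesis using j by blast
  qed
  have 2: "y \<in> set ss \<and> (Br x y, y) \<in> list_order ss \<and> Br x y \<noteq> y" if xy: "Br x y \<in> set ss" for x y
  proof -
    obtain j l where jl: "l < j" "j < length ss" "Br x y = ss ! j" "y = ss ! l"
      using right[OF xy] by blast
    then have "(ss ! j, ss ! l) \<in> list_order ss" "ss ! l \<in> set ss"
      using ord[of l j] by auto
    moreover have "ss ! j \<noteq> ss ! l"
      using jl assms(3) by (simp add: nth_eq_iff_index_eq)
    ultimately show ?thesis
      using jl(3,4) by simp
  qed
  \<comment> \<open>An entry with right factor \<open>ss ! l\<close> must have been created by the
    elimination of \<open>ss ! l\<close>, and is therefore a comb over a vertex of that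
    graph.\<close>
  have comb: "\<exists>z m. Br x y = left_comb z y m \<and> m > 0 \<and> z \<in> active ss l - {y} \<and> \<not> indep \<theta> z y"
    and comb_in: "Br x y \<in> active ss (Suc l)"
    if xy: "Br x y \<in> set ss" "y = ss ! l" "l < length ss" for x y l
  proof -
    obtain j l' where "l' < j" "j < length ss" "Br x y = ss ! j" "y = ss ! l'"
      using right[OF xy(1)] by blast
    moreover from this have "l' = l"
      using xy assms(3) by (simp add: nth_eq_iff_index_eq)
    ultimately show in_Suc: "Br x y \<in> active ss (Suc l)"
      using nth_drop[of j "Suc l"] nth_take[of l "Suc l"] xy by (auto simp: active_def)
    have "Br x y \<notin> active ss l"
      using nth_take[of l l] xy by (auto simp: active_def)
    then show "\<exists>z m. Br x y = left_comb z y m \<and> m > 0 \<and> z \<in> active ss l - {y} \<and> \<not> indep \<theta> z y"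
      using in_Suc step[OF xy(3)] xy(2) by (auto simp: star_def)
  qed
  have 3: "Br h' h'' \<in> set ss \<longleftrightarrow> h' \<in> set ss \<and> h'' \<in> set ss \<and> (h', h'') \<in> list_order ss \<and> h' \<noteq> h''
      \<and> \<not> indep \<theta> h' h'' \<and> (h' \<in> Letter ` A \<or> (\<exists>x y. h' = Br x y \<and> (h'', y) \<in> list_order ss))"
    if U: "Br h' h'' \<in> free_magma_le A n" for h' h''
  proof
    assume L: "Br h' h'' \<in> set ss"
    obtain l where l: "l < length ss" "h'' = ss ! l"
      using 2[OF L] by (metis in_set_conv_nth)
    obtain z m where z: "Br h' h'' = left_comb z h'' m" "m > 0" "z \<in> active ss l" "z \<noteq> h''"
      "\<not> indep \<theta> z h''"
      using comb[OF L l(2,1)] by auto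
    then have h': "h' = left_comb z h'' (m - 1)"
      by (simp add: left_comb_pos)
    \<comment> \<open>The left factor has one copy of \<open>h''\<close> fewer: it is either
      \<open>z\<close> or a shorter comb, and both lie in the same star. So \<open>h'\<close> is
      eliminated after \<open>h''\<close>, and its right factor, if any, no later than
      \<open>h''\<close>.\<close>
    have "h' \<in> active ss (Suc l)"
    proof (cases "m - 1 = 0")
      case True
      then have "h' = z" using h' by simp
      moreover have "z \<in> free_magma_le A n"
        using free_magma_le_Br[OF U] \<open>h' = z\<close> by simp
      ultimately show ?thesis
        using z l step[OF l(1)] by (auto simp: star_def)
    next
      case False
      then have "\<exists>z m. h' = left_comb z (ss ! l) m \<and> m > 0 \<and> z \<in> active ss l - {ss ! l}
          \<and> \<not> indep \<theta> z (ss ! l)"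
        using h' z l(2) by (intro exI[of _ z] exI[of _ "m - 1"]) simp
      then show ?thesis
        unfolding step[OF l(1)] star_iff using free_magma_le_Br[OF U] by simp
    qed
    then have "h' \<in> set (drop (Suc l) ss)"
      by (simp add: active_def)
    then obtain j where j: "l < j" "j < length ss" "h' = ss ! j"
      using in_set_drop_nth[OF assms(3)] Suc_le_eq by metis
    have "h' \<in> Letter ` A \<or> (\<exists>x y. h' = Br x y \<and> (h'', y) \<in> list_order ss)"
    proof (cases h')
      case (Letter a)
      then show ?thesis using U by (auto simp: free_magma_le_def)
    next
      case (Br x y)
      then have "y \<in> set (take (Suc l) ss)"
        using \<open>h' \<in> active ss (Suc l)\<close> by (auto simp: active_def)
      then obtain p where "p \<le> l" "y = ss ! p"
        by (auto simp: in_set_conv_nth less_Suc_eq_le)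
      then show ?thesis
        using Br l ord[of p l] by auto
    qed
    moreover have "(h', h'') \<in> list_order ss" "h' \<noteq> h''"
      using j l ord[of l j] nth_eq_iff_index_eq[OF assms(3), of j l] by auto
    moreover have "\<not> indep \<theta> h' h''"
      unfolding h' using not_indep_left_comb[OF assms(1) z(5)] .
    ultimately show "h' \<in> set ss \<and> h'' \<in> set ss \<and> (h', h'') \<in> list_order ss \<and> h' \<noteq> h''
      \<and> \<not> indep \<theta> h' h'' \<and> (h' \<in> Letter ` A \<or> (\<exists>x y. h' = Br x y \<and> (h'', y) \<in> list_order ss))"
      using j l by simp
  next
    assume R: "h' \<in> set ss \<and> h'' \<in> set ss \<and> (h', h'') \<in> list_order ss \<and> h' \<noteq> h''
      \<and> \<not> indep \<theta> h' h'' \<and> (h' \<in> Letter ` A \<or> (\<exists>x y. h' = Br x y \<and> (h'', y) \<in> list_order ss))"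
    then obtain j l where jl: "j < length ss" "l < length ss" "h' = ss ! j" "h'' = ss ! l"
      by (metis in_set_conv_nth)
    then have "l \<le> j"
      using R ord by auto
    \<comment> \<open>If the right factor of \<open>h'\<close> equals \<open>h''\<close>, then
      \<open>h'\<close> is a comb that takes one more copy. If it is strictly greater, or
      \<open>h'\<close> is a letter, then \<open>h'\<close> was active when \<open>h''\<close> was
      eliminated and is itself the base.\<close>
    have "\<exists>z m. Br h' h'' = left_comb z h'' m \<and> m > 0 \<and> z \<in> active ss l - {h''} \<and> \<not> indep \<theta> z h''"
    proof (cases "\<exists>x. h' = Br x h''")
      case True
      then obtain x where x: "h' = Br x h''" by auto
      then obtain z m where "h' = left_comb z h'' m" "z \<in> active ss l - {h''}" "\<not> indep \<theta> z h''"
        using comb[OF _ jl(4,2), of x] R by auto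
      then show ?thesis
        by (intro exI[of _ z] exI[of _ "Suc m"]) auto
    next
      case False
      have "y \<in> set (take l ss)" if "h' = Br x y" for x y
      proof -
        have y: "(h'', y) \<in> list_order ss" "y \<noteq> h''"
          using R that False by auto
        have "y \<in> set ss"
          using 2[of x y] R that by blast
        then obtain p where p: "p < length ss" "y = ss ! p"
          unfolding in_set_conv_nth by blast
        have "p \<le> l"
          using y(1) ord[OF p(1) jl(2)] unfolding p(2) jl(4) by blast
        moreover have "p \<noteq> l"
          using y(2) p(2) jl(4) by blast
        ultimately show ?thesis
          unfolding p(2) using nth_take[OF p(1), of l] by simp
      qed
      then have "h' \<in> active ss l"
        using jl \<open>l \<le> j\<close> nth_drop[of j l] by (auto simp: active_def)
      then show ?thesis
        using R by (intro exI[of _ h'] exI[of _ 1]) auto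
    qed
    then have "Br h' h'' \<in> star A \<theta> n (ss ! l) (active ss l)"
      using U jl(4) unfolding star_def by auto
    then show "Br h' h'' \<in> set ss"
      using step[OF jl(2)] by (auto simp: active_def dest: in_set_dropD)
  qed
  show ?thesis
    using 1 2 3 by (rule hall_rulesI)
qed

lemma hall_rules_lazard_run:
  assumes "irrefl \<theta>" "distinct ss" "set ss \<subseteq> free_magma_le A n"
    "hall_rules A \<theta> (free_magma_le A n) (set ss) (list_order ss)"
  shows "lazard_run A \<theta> n ss (active ss)"
proof -
  note nth_take = nth_in_take_iff[OF assms(2)] and nth_drop = nth_in_drop_iff[OF assms(2)]
    and ord = list_order_nth_iff[OF assms(2)]
  have letters: "Letter ` A \<subseteq> set ss"
    and right: "Br x y \<in> set ss \<Longrightarrow> y \<in> set ss \<and> (Br x y, y) \<in> list_order ss \<and> Br x y \<noteq> y"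
    and Br_iff: "Br x y \<in> free_magma_le A n \<Longrightarrow> Br x y \<in> set ss \<longleftrightarrow>
      x \<in> set ss \<and> y \<in> set ss \<and> (x, y) \<in> list_order ss \<and> x \<noteq> y \<and> \<not> indep \<theta> x y \<and>
        (x \<in> Letter ` A \<or> (\<exists>x' y'. x = Br x' y' \<and> (y, y') \<in> list_order ss))" for x y
    using hall_rulesD[OF assms(4)] by simp_all
  have less_iff: "(t, ss ! i) \<in> list_order ss \<and> t \<noteq> ss ! i \<longleftrightarrow> t \<in> set (drop (Suc i) ss)"
    if "t \<in> set ss" "i < length ss" for t i
    using that nth_drop[of _ "Suc i"] ord[of i] nth_eq_iff_index_eq[OF assms(2), of _ i]
    by (auto simp: in_set_conv_nth[of t ss])
  have greater_iff: "(ss ! i, t) \<in> list_order ss \<longleftrightarrow> t \<in> set (take (Suc i) ss)"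
    if "t \<in> set ss" "i < length ss" for t i
    using that nth_take[of _ "Suc i"] ord[of _ i] by (auto simp: in_set_conv_nth[of t ss])
  have take_Suc: "set (take (Suc i) ss) = insert (ss ! i) (set (take i ss))" if "i < length ss" for i
    using that by (simp add: take_Suc_conv_app_nth)
  have drop_Suc: "set (drop i ss) = insert (ss ! i) (set (drop (Suc i) ss))" if "i < length ss" for i
    using that by (simp add: Cons_nth_drop_Suc[symmetric])
  have drop_ne: "ss ! i \<notin> set (drop (Suc i) ss)" if "i < length ss" for i
    using nth_drop[OF that] by simp
  have "active ss 0 = Letter ` A"
  proof -
    have "t \<in> Letter ` A" if "t \<in> active ss 0" for t
      using that assms(3) by (cases t) (auto simp: active_def free_magma_le_def)
    then show ?thesis
      using letters by (auto simp: active_def)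
  qed
  moreover have "ss ! i \<in> active ss i" if i: "i < length ss" for i
  proof -
    have "y \<in> set (take i ss)" if "ss ! i = Br x y" for x y
    proof -
      have "y \<in> set ss \<and> (ss ! i, y) \<in> list_order ss \<and> ss ! i \<noteq> y"
        using right[of x y] that nth_mem[OF i] by simp
      then show ?thesis
        using greater_iff[of y i] take_Suc i by auto
    qed
    then show ?thesis
      using nth_drop[OF i, of i] by (auto simp: active_def)
  qed
  moreover have "active ss (Suc i) = star A \<theta> n (ss ! i) (active ss i)" if i: "i < length ss" for i
  proof (intro subset_antisym subsetI)
    let ?s = "ss ! i"
    \<comment> \<open>Induction on the left factor strips copies of \<open>ss ! i\<close> until the
      right factor differs from \<open>ss ! i\<close>, or a letter is reached; what remains is the
      active base.\<close>
    have comb: "\<exists>z m. Br x ?s = left_comb z ?s m \<and> m > 0 \<and> z \<in> active ss i - {?s} \<and> \<not> indep \<theta> z ?s"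
      if "Br x ?s \<in> set ss" for x
      using that
    proof (induction x)
      case (Letter a)
      then have "Letter a \<in> set ss \<and> (Letter a, ?s) \<in> list_order ss \<and> Letter a \<noteq> ?s \<and> \<not> indep \<theta> (Letter a) ?s"
        using Br_iff[of "Letter a" ?s] assms(3) by auto
      then show ?case
        using less_iff[of "Letter a" i] i drop_Suc
        by (intro exI[of _ "Letter a"] exI[of _ 1]) (auto simp: active_def)
    next
      case (Br x y)
      then have xy: "Br x y \<in> set ss" "(Br x y, ?s) \<in> list_order ss" "Br x y \<noteq> ?s"
          "\<not> indep \<theta> (Br x y) ?s" "(?s, y) \<in> list_order ss"
        using Br_iff[of "Br x y" ?s] assms(3) by auto
      show ?case
      proof (cases "y = ?s")
        case True
        then obtain z m where "Br x y = left_comb z ?s m" "z \<in> active ss i - {?s}" "\<not> indep \<theta> z ?s"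
          using Br.IH(1) xy(1) by auto
        then show ?thesis
          by (intro exI[of _ z] exI[of _ "Suc m"]) auto
      next
        case False
        then have "y \<in> set (take i ss)"
          using xy(1,5) right[of x y] greater_iff[of y i] take_Suc i by auto
        then have "Br x y \<in> active ss i"
          using less_iff[of "Br x y" i] xy i drop_Suc by (auto simp: active_def)
        then show ?thesis
          using xy by (intro exI[of _ "Br x y"] exI[of _ 1]) auto
      qed
    qed
    fix t assume t: "t \<in> active ss (Suc i)"
    then have "t \<in> set ss" "t \<noteq> ?s" "t \<in> free_magma_le A n"
      using drop_ne[OF i] assms(3) by (auto simp: active_def dest: in_set_dropD)
    moreover have "t \<in> active ss i" if "\<not> (\<exists>x. t = Br x ?s)"
      using t that take_Suc[OF i] drop_Suc[OF i] by (auto simp: active_def)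
    moreover have "\<exists>z m. t = left_comb z ?s m \<and> m > 0 \<and> z \<in> active ss i - {?s} \<and> \<not> indep \<theta> z ?s"
      if "\<exists>x. t = Br x ?s"
      using that comb calculation(1) by blast
    ultimately show "t \<in> star A \<theta> n ?s (active ss i)"
      unfolding star_iff by blast
  next
    let ?s = "ss ! i"
    fix t assume "t \<in> star A \<theta> n ?s (active ss i)"
    then consider "t \<in> active ss i - {?s}" | z m where "t = left_comb z ?s m" "m > 0"
        "t \<in> free_magma_le A n" "z \<in> active ss i - {?s}" "\<not> indep \<theta> z ?s"
      unfolding star_iff by blast
    then show "t \<in> active ss (Suc i)"
    proof cases
      case 1
      then show ?thesis
        using take_Suc[OF i] drop_Suc[OF i] by (auto simp: active_def)
    next
      case (2 z m)
      \<comment> \<open>Combs are built up one copy at a time. The Hall rule asks for a right factor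
        of the left part that is at least \<open>ss ! i\<close>: for the base it was eliminated
        earlier, and from the first copy on it is \<open>ss ! i\<close> itself.\<close>
      have *: "left_comb z ?s k \<in> free_magma_le A n \<Longrightarrow> left_comb z ?s k \<in> set (drop (Suc i) ss)" for k
      proof (induction k)
        case 0
        then show ?case using 2 drop_Suc[OF i] by (auto simp: active_def)
      next
        case (Suc k)
        let ?t = "left_comb z ?s k"
        have "?t \<in> set (drop (Suc i) ss)"
          using Suc.IH Suc.prems free_magma_le_Br[of ?t ?s A n] by auto
        then have t: "?t \<in> set ss" "(?t, ?s) \<in> list_order ss" "?t \<noteq> ?s"
          using less_iff[of ?t i] i by (auto dest: in_set_dropD)
        have "?t \<in> Letter ` A \<or> (\<exists>x' y'. ?t = Br x' y' \<and> (?s, y') \<in> list_order ss)"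
        proof (cases k)
          case 0
          show ?thesis
          proof (cases z)
            case (Letter a)
            then show ?thesis using 0 t assms(3) by (auto simp: free_magma_le_def)
          next
            case (Br x y)
            then have "y \<in> set (take i ss)"
              using 2 by (auto simp: active_def)
            then show ?thesis
              using 0 Br greater_iff[OF in_set_takeD i] take_Suc[OF i] by simp
          qed
        next
          case (Suc l)
          then show ?thesis using ord[OF i i] by simp
        qed
        then have "Br ?t ?s \<in> set ss"
          using Br_iff[of ?t ?s] Suc.prems t nth_mem[OF i] not_indep_left_comb[OF assms(1) 2(5), of k]
          by simp
        then show ?case
          using right[of ?t ?s] less_iff[OF _ i, of "Br ?t ?s"] by simp
      qed
      then have "t \<in> set (drop (Suc i) ss)"
        using 2 by blast
      moreover have "?s \<in> set (take (Suc i) ss)"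
        using take_Suc[OF i] by simp
      ultimately show ?thesis
        using 2(1,2) by (auto simp: active_def left_comb_pos)
    qed
  qed
  ultimately show ?thesis
    by (simp add: lazard_run_def active_def)
qed

section \<open>Graphs of Lazard elimination\<close>

lemma edge_commutation_graph_iff:
  assumes "sym \<theta>" "irrefl \<theta>" "V \<subseteq> free_magma A"
  shows "{s, t} \<in> snd (commutation_graph A \<theta> V) \<longleftrightarrow> s \<in> V \<and> t \<in> V \<and> indep \<theta> s t"
proof -
  have "{s, t} \<in> snd (commutation_graph A \<theta> V) \<longleftrightarrow> (\<exists>s' t'. {s, t} = {s', t'} \<and> s' \<in> V \<and> t' \<in> V
      \<and> (foliage A \<theta> s', foliage A \<theta> t') \<in> trace_commutation A \<theta>)"
    unfolding commutation_graph_def by auto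
  also have "\<dots> \<longleftrightarrow> (\<exists>s' t'. {s, t} = {s', t'} \<and> s' \<in> V \<and> t' \<in> V \<and> indep \<theta> s' t')"
    using trace_commutation_foliage[OF assms(1,2)] assms(3) by blast
  also have "\<dots> \<longleftrightarrow> s \<in> V \<and> t \<in> V \<and> indep \<theta> s t"
    using indep_sym[OF assms(1)] by (auto simp: doubleton_eq_iff)
  finally show ?thesis .
qed

lemma alphabet_graph_eq:
  assumes "\<theta> \<subseteq> A \<times> A" "sym \<theta>" "irrefl \<theta>"
  shows "alphabet_graph A \<theta> = commutation_graph A \<theta> (Letter ` A)"
proof -
  have "(foliage A \<theta> (Letter a), foliage A \<theta> (Letter b)) \<in> trace_commutation A \<theta> \<longleftrightarrow> (a, b) \<in> \<theta>"
    if "a \<in> A" "b \<in> A" for a b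
    using trace_commutation_foliage[OF assms(2,3), of "Letter a" A "Letter b"] that
    by (simp add: indep_def del: foliage.simps)
  then show ?thesis
    using assms(1) unfolding alphabet_graph_def commutation_graph_def by blast
qed

lemma H_star_commutation_graph:
  assumes "sym \<theta>" "irrefl \<theta>" "V \<subseteq> free_magma A" "s \<in> V"
  shows "H_star A \<theta> n s (commutation_graph A \<theta> V) = commutation_graph A \<theta> (star A \<theta> n s V)"
proof -
  have edge: "{z, s} \<notin> snd (commutation_graph A \<theta> V) \<longleftrightarrow> \<not> indep \<theta> z s" if "z \<in> V" for z
    using edge_commutation_graph_iff[OF assms(1-3)] that assms(4) by simp
  let ?S = "(V \<inter> free_magma_le A n - {s}) \<union>
     {left_comb z s m |z m. left_comb z s m \<in> free_magma_le A n \<and> m > 0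
        \<and> z \<in> V - {s} \<and> {z, s} \<notin> snd (commutation_graph A \<theta> V)}"
  have "t \<in> ?S \<longleftrightarrow> t \<in> star A \<theta> n s V" for t
  proof
    assume "t \<in> ?S"
    then consider "t \<in> V - {s}" "t \<in> free_magma_le A n" | z m where "t = left_comb z s m"
        "t \<in> free_magma_le A n" "m > 0" "z \<in> V - {s}" "\<not> indep \<theta> z s"
      using edge by auto
    then show "t \<in> star A \<theta> n s V"
      by cases (auto simp only: star_iff)
  next
    assume "t \<in> star A \<theta> n s V"
    then consider "t \<in> V - {s}" "t \<in> free_magma_le A n" | z m where "t = left_comb z s m"
        "t \<in> free_magma_le A n" "m > 0" "z \<in> V - {s}" "\<not> indep \<theta> z s"
      unfolding star_iff by blast
    then show "t \<in> ?S"
    proof cases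
      case (2 z m)
      then show ?thesis
        using edge[of z] by (intro UnI2 CollectI exI[of _ z] exI[of _ m]) simp
    qed simp
  qed
  then have "?S = star A \<theta> n s V"
    by (rule Set.set_eqI)
  then show ?thesis
    unfolding H_star_def by (simp add: commutation_graph_def)
qed

lemma eliminable_commutation_graph:
  assumes "sym \<theta>" "irrefl \<theta>" "V \<subseteq> free_magma A"
    "complete_elimination_string (commutation_graph A \<theta> V) as" "as \<noteq> []"
  shows "eliminable \<theta> (hd as) V"
  unfolding eliminable_def
proof (intro ballI impI)
  fix z z' assume z: "z \<in> V - {hd as}" "z' \<in> V - {hd as}" "indep \<theta> z z'"
  have fst: "fst (commutation_graph A \<theta> V) = V"
    by (simp add: commutation_graph_def)
  have "as ! 0 = hd as" "take (Suc 0) as = [hd as]"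
    using assms(5) by (cases as; simp)+
  moreover have "\<forall>i < length as. \<forall>v\<^sub>1 \<in> V - set (take (Suc i) as). \<forall>v\<^sub>2 \<in> V - set (take (Suc i) as).
      {v\<^sub>1, v\<^sub>2} \<in> snd (commutation_graph A \<theta> V) \<longrightarrow>
      {v\<^sub>1, as ! i} \<in> snd (commutation_graph A \<theta> V) \<or> {v\<^sub>2, as ! i} \<in> snd (commutation_graph A \<theta> V)"
    using assms(4) unfolding complete_elimination_string_def elimination_string_def fst by simp
  ultimately have "{z, z'} \<in> snd (commutation_graph A \<theta> V) \<longrightarrow>
      {z, hd as} \<in> snd (commutation_graph A \<theta> V) \<or> {z', hd as} \<in> snd (commutation_graph A \<theta> V)"
    using assms(5) z(1,2) by (metis length_greater_0_conv list.set(1,2))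
  then show "indep \<theta> z (hd as) \<or> indep \<theta> z' (hd as)"
    using z edge_commutation_graph_iff[OF assms(1-3)] by auto
qed

lemma lazard_run_elim_chain:
  assumes "lazard_run A \<theta> n ss V" "\<And>i. i < length ss \<Longrightarrow> eliminable \<theta> (ss ! i) (V i)"
  shows "elim_chain A \<theta> n ss (Letter ` A)"
proof -
  have "elim_chain A \<theta> n (drop i ss) (V i)" if "i \<le> length ss" for i
    using that
  proof (induction rule: inc_induct)
    case base
    then show ?case using assms(1) by (simp add: lazard_run_def)
  next
    case (step i)
    then show ?case
      using assms by (simp add: lazard_run_def Cons_nth_drop_Suc[symmetric])
  qed
  from this[of 0] show ?thesis
    using assms(1) by (simp add: lazard_run_def)
qed

lemma transitive_Lazard_set_run:
  assumes "\<theta> \<subseteq> A \<times> A" "sym \<theta>" "irrefl \<theta>" "transitive_Lazard_set A \<theta> L" "n > 0"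
  shows "\<exists>ss V. distinct ss \<and> set ss = L \<inter> free_magma_le A n \<and> lazard_run A \<theta> n ss V \<and>
    (\<forall>i < length ss. eliminable \<theta> (ss ! i) (V i))"
proof -
  from assms(4,5) obtain ss G where ss: "distinct ss" "set ss = L \<inter> free_magma_le A n"
    and G0: "G 0 = alphabet_graph A \<theta>" and Glen: "G (length ss) = ({}, {})"
    and G: "\<forall>i < length ss. ss ! i \<in> fst (G i) \<and>
        (\<exists>as. complete_elimination_string (G i) as \<and> as \<noteq> [] \<and> hd as = ss ! i) \<and>
        G (Suc i) = H_star A \<theta> n (ss ! i) (G i)"
    unfolding transitive_Lazard_set_def by blast
  define V where "V i = fst (G i)" for i
  have fst: "fst (commutation_graph A \<theta> W) = W" for W
    by (simp add: commutation_graph_def)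
  have V0: "V 0 = Letter ` A"
    by (simp add: V_def G0 alphabet_graph_def)
  have GV: "G i = commutation_graph A \<theta> (V i) \<and> V i \<subseteq> free_magma A" if "i \<le> length ss" for i
    using that
  proof (induction i)
    case 0
    then show ?case
      using alphabet_graph_eq[OF assms(1-3)] by (auto simp: V0 G0)
  next
    case (Suc i)
    then have "ss ! i \<in> V i" "G (Suc i) = H_star A \<theta> n (ss ! i) (commutation_graph A \<theta> (V i))"
      "V i \<subseteq> free_magma A"
      using G by (auto simp: V_def)
    then have "G (Suc i) = commutation_graph A \<theta> (star A \<theta> n (ss ! i) (V i))"
      using H_star_commutation_graph[OF assms(2,3)] by simp
    then show ?case
      using star_free_magma by (simp add: V_def fst)
  qed
  have "ss ! i \<in> V i" "V (Suc i) = star A \<theta> n (ss ! i) (V i)" "eliminable \<theta> (ss ! i) (V i)"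
    if i: "i < length ss" for i
  proof -
    have Gi: "G i = commutation_graph A \<theta> (V i)" "V i \<subseteq> free_magma A"
      using GV[of i] i by auto
    show "ss ! i \<in> V i"
      using G i by (simp add: V_def)
    then have "G (Suc i) = commutation_graph A \<theta> (star A \<theta> n (ss ! i) (V i))"
      using G i Gi H_star_commutation_graph[OF assms(2,3)] by simp
    then show "V (Suc i) = star A \<theta> n (ss ! i) (V i)"
      by (simp add: V_def[of "Suc i"] fst)
    show "eliminable \<theta> (ss ! i) (V i)"
      using G i eliminable_commutation_graph[OF assms(2,3) Gi(2)] unfolding Gi(1)[symmetric] by metis
  qed
  moreover have "V (length ss) = {}"
    by (simp add: V_def Glen)
  ultimately have "lazard_run A \<theta> n ss V" "\<forall>i < length ss. eliminable \<theta> (ss ! i) (V i)"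
    using V0 by (auto simp: lazard_run_def)
  then show ?thesis using ss by blast
qed

lemma transitive_Lazard_setI:
  assumes "\<theta> \<subseteq> A \<times> A" "sym \<theta>" "irrefl \<theta>"
    "\<And>n. n > 0 \<Longrightarrow> \<exists>ss V. distinct ss \<and> set ss = L \<inter> free_magma_le A n \<and> lazard_run A \<theta> n ss V \<and>
      (\<forall>i < length ss. \<exists>as. complete_elimination_string (commutation_graph A \<theta> (V i)) as \<and>
        as \<noteq> [] \<and> hd as = ss ! i)"
  shows "transitive_Lazard_set A \<theta> L"
  unfolding transitive_Lazard_set_def
proof (intro allI impI)
  fix n :: nat assume "n > 0"
  then obtain ss V where ss: "distinct ss" "set ss = L \<inter> free_magma_le A n" "lazard_run A \<theta> n ss V"
    and as: "\<forall>i < length ss. \<exists>as. complete_elimination_string (commutation_graph A \<theta> (V i)) as \<and>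
        as \<noteq> [] \<and> hd as = ss ! i"
    using assms(4) by blast
  let ?G = "\<lambda>i. commutation_graph A \<theta> (V i)"
  have "V i \<subseteq> free_magma A" if "i \<le> length ss" for i
    using that ss(3) star_free_magma[of A \<theta> n] by (cases i) (auto simp: lazard_run_def)
  then have "?G (Suc i) = H_star A \<theta> n (ss ! i) (?G i)" if "i < length ss" for i
    using that ss(3) H_star_commutation_graph[OF assms(2,3), of "V i" A "ss ! i" n]
    by (simp add: lazard_run_def)
  moreover have "?G 0 = alphabet_graph A \<theta>"
    using ss(3) alphabet_graph_eq[OF assms(1-3)] by (simp add: lazard_run_def)
  moreover have "?G (length ss) = ({}, {})"
    using ss(3) by (simp add: lazard_run_def commutation_graph_def)
  moreover have "ss ! i \<in> fst (?G i)" if "i < length ss" for i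
    using ss(3) that by (simp add: lazard_run_def commutation_graph_def)
  ultimately show "\<exists>ss G. distinct ss \<and> set ss = L \<inter> free_magma_le A n \<and> G 0 = alphabet_graph A \<theta> \<and>
      G (length ss) = ({}, {}) \<and> (\<forall>i < length ss. ss ! i \<in> fst (G i) \<and>
        (\<exists>as. complete_elimination_string (G i) as \<and> as \<noteq> [] \<and> hd as = ss ! i) \<and>
        G (Suc i) = H_star A \<theta> n (ss ! i) (G i))"
    using ss(1,2) as by (intro exI[of _ ss] exI[of _ ?G]) simp
qed

section \<open>From Hall sets to Lazard sets\<close>

lemma transitive_Hall_set_iff:
  assumes "sym \<theta>" "irrefl \<theta>" "H \<subseteq> free_magma A"
  shows "transitive_Hall_set A \<theta> H r \<longleftrightarrow> linear_order_on H r \<and> hall_rules A \<theta> (free_magma A) H r \<and>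
    (\<forall>w. set w \<subseteq> A \<longrightarrow>
      (\<exists>!x. set x \<subseteq> H \<and> sorted_wrt (\<lambda>s t. (t, s) \<in> r) x \<and> (w, words x) \<in> trace_cong A \<theta>))"
proof -
  have "(foliage A \<theta> h', foliage A \<theta> h'') \<notin> trace_commutation A \<theta> \<longleftrightarrow> \<not> indep \<theta> h' h''"
    if "Br h' h'' \<in> free_magma A" for h' h''
    using that trace_commutation_foliage[OF assms(1,2)] by simp
  then show ?thesis
    unfolding transitive_Hall_set_def hall_rules_def complete_factorization_foliage_iff[OF assms(3)]
    using assms(3) by (auto cong: conj_cong)
qed

text \<open>If \<open>z\<close> and \<open>z'\<close> commute with each other but not with \<open>v\<close>, then reading the trace of \<open>z z' v\<close> as
  \<open>z (z' v)\<close> and as \<open>z' (z v)\<close> yields two different decreasing factorizations.\<close>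

lemma transitive_Hall_set_commuting:
  assumes "sym \<theta>" "irrefl \<theta>" "H \<subseteq> free_magma A" "transitive_Hall_set A \<theta> H r"
    and v: "v \<in> H"
    and z: "z \<in> H" "(z, v) \<in> r" "z \<noteq> v" "\<And>x y. z = Br x y \<Longrightarrow> (v, y) \<in> r"
    and z': "z' \<in> H" "(z', v) \<in> r" "z' \<noteq> v" "\<And>x y. z' = Br x y \<Longrightarrow> (v, y) \<in> r"
    and indep: "indep \<theta> z z'"
  shows "indep \<theta> z v \<or> indep \<theta> z' v"
proof (rule ccontr)
  assume "\<not> ?thesis"
  then have nz: "\<not> indep \<theta> z v" "\<not> indep \<theta> z' v" by auto
  have lin: "linear_order_on H r" and hall: "hall_rules A \<theta> (free_magma A) H r"
    and uniq: "\<And>w. set w \<subseteq> A \<Longrightarrow>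
      \<exists>!x. set x \<subseteq> H \<and> sorted_wrt (\<lambda>s t. (t, s) \<in> r) x \<and> (w, words x) \<in> trace_cong A \<theta>"
    using assms(4) unfolding transitive_Hall_set_iff[OF assms(1-3)] by auto
  note rules = hall_rulesD[OF hall]
  have r: "trans r" "refl_on H r" "total_on H r"
    using lin by (auto simp: order_on_defs)
  have Br_in: "Br p q \<in> H"
    if "p \<in> H" "q \<in> H" "(p, q) \<in> r" "p \<noteq> q" "\<not> indep \<theta> p q" "\<And>x y. p = Br x y \<Longrightarrow> (q, y) \<in> r" for p q
  proof -
    have "Br p q \<in> free_magma A"
      using that(1,2) assms(3) by auto
    moreover have "p \<in> Letter ` A \<or> (\<exists>x y. p = Br x y \<and> (q, y) \<in> r)"
      using that(1,6) assms(3) by (cases p) auto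
    ultimately show ?thesis
      using rules(3)[of p q] that by simp
  qed
  \<comment> \<open>If \<open>Br q v\<close> is at most \<open>p\<close>, the two-term list is
    already decreasing. Otherwise \<open>p\<close> is smaller and \<open>Br p (Br q v)\<close>
    satisfies the Hall rule: a right factor of \<open>p\<close> is at least \<open>v\<close>, which
    exceeds \<open>Br q v\<close>, and \<open>p\<close> does not commute with \<open>Br q v\<close>
    because it does not commute with \<open>v\<close>.\<close>
  have factorization: "\<exists>x. (x = [p, Br q v] \<or> x = [Br p (Br q v)]) \<and> set x \<subseteq> H \<and>
      sorted_wrt (\<lambda>s t. (t, s) \<in> r) x"
    if p: "p \<in> H" "\<not> indep \<theta> p v" "\<And>x y. p = Br x y \<Longrightarrow> (v, y) \<in> r"
      and q: "q \<in> H" "(q, v) \<in> r" "q \<noteq> v" "\<not> indep \<theta> q v" "\<And>x y. q = Br x y \<Longrightarrow> (v, y) \<in> r" for p q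
  proof -
    have qv: "Br q v \<in> H"
      by (rule Br_in[OF q(1) v q(2-5)])
    show ?thesis
    proof (cases "(Br q v, p) \<in> r")
      case True
      then show ?thesis
        using qv p(1) by (intro exI[of _ "[p, Br q v]"]) simp
    next
      case False
      have ne: "p \<noteq> Br q v"
        using False r(2) p(1) by (auto simp: refl_on_def)
      moreover have "(p, Br q v) \<in> r"
        using False r(3) p(1) qv ne unfolding total_on_def by metis
      moreover have "(Br q v, y) \<in> r" if "p = Br x y" for x y
        using transD[OF r(1), of "Br q v" v y] rules(2)[OF qv] p(3)[OF that] by simp
      ultimately have "Br p (Br q v) \<in> H"
        using p(1,2) qv by (intro Br_in[of p "Br q v"]) simp_all
      then show ?thesis
        by (intro exI[of _ "[Br p (Br q v)]"]) simp
    qed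
  qed
  have "\<exists>x. (x = [z, Br z' v] \<or> x = [Br z (Br z' v)]) \<and> set x \<subseteq> H \<and>
      sorted_wrt (\<lambda>s t. (t, s) \<in> r) x"
    by (rule factorization; fact z z' nz)
  then obtain x where x: "x = [z, Br z' v] \<or> x = [Br z (Br z' v)]" "set x \<subseteq> H"
      "sorted_wrt (\<lambda>s t. (t, s) \<in> r) x"
    by (elim exE conjE) (rule that)
  have "\<exists>x. (x = [z', Br z v] \<or> x = [Br z' (Br z v)]) \<and> set x \<subseteq> H \<and>
      sorted_wrt (\<lambda>s t. (t, s) \<in> r) x"
    by (rule factorization; fact z z' nz)
  then obtain x' where x': "x' = [z', Br z v] \<or> x' = [Br z' (Br z v)]" "set x' \<subseteq> H"
      "sorted_wrt (\<lambda>s t. (t, s) \<in> r) x'"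
    by (elim exE conjE) (rule that)
  have A: "leaves z \<subseteq> A" "leaves z' \<subseteq> A" "leaves v \<subseteq> A"
    using z(1) z'(1) v assms(3) unfolding free_magma_def by fast+
  let ?w = "word z @ word z' @ word v"
  have w: "words x = ?w" "words x' = word z' @ word z @ word v"
    using x(1) x'(1) by auto
  have "((word z @ word z') @ word v, (word z' @ word z) @ word v) \<in> trace_cong A \<theta>"
    using A indep by (intro trace_cong.append trace_cong_commute trace_cong.refl)
      (auto simp: lists_eq_set indep_def)
  then have "(?w, words x') \<in> trace_cong A \<theta>"
    using w by simp
  moreover have "(?w, words x) \<in> trace_cong A \<theta>"
    unfolding w(1) using A by (intro trace_cong.refl) (simp add: lists_eq_set)
  moreover have "set ?w \<subseteq> A"
    using A by simp
  ultimately have "x = x'"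
    using uniq[of ?w] x x' by blast
  \<comment> \<open>Equal lengths leave only the two matching shapes, and each forces
    \<open>z = z'\<close>; but a tree never commutes with itself.\<close>
  then have "z = z'"
    using x(1) x'(1) by auto
  then show False
    using indep not_indep_self[OF assms(2)] by simp
qed

lemma transitive_Hall_imp_Lazard:
  assumes "finite A" "\<theta> \<subseteq> A \<times> A" "sym \<theta>" "irrefl \<theta>" "H \<subseteq> free_magma A"
    "transitive_Hall_set A \<theta> H r"
  shows "transitive_Lazard_set A \<theta> H"
proof (rule transitive_Lazard_setI[OF assms(2-4)])
  fix n :: nat assume n: "n > 0"
  have lin: "linear_order_on H r" and hall: "hall_rules A \<theta> (free_magma A) H r"
    using assms(6) unfolding transitive_Hall_set_iff[OF assms(3-5)] by auto
  let ?X = "H \<inter> free_magma_le A n"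
  obtain xs where xs: "set xs = ?X" "distinct xs"
    using finite_distinct_list[of ?X] finite_free_magma_le[OF assms(1)] by auto
  obtain ss where "sorted_wrt (\<lambda>s t. (s, t) \<in> r\<inverse>) ss" "mset ss = mset xs"
    using ex_sorted_wrt_mset[of H "r\<inverse>" xs] lin xs(1) by auto
  then have ss: "sorted_wrt (\<lambda>s t. (t, s) \<in> r) ss" "set ss = ?X" "distinct ss"
    using xs mset_eq_setD[of ss xs] mset_eq_imp_distinct_iff[of ss xs] by simp_all
  have order: "(s, t) \<in> list_order ss \<longleftrightarrow> (s, t) \<in> r" if "s \<in> ?X" "t \<in> ?X" for s t
    using list_order_sorted[OF lin _ ss(3,1)] that ss(2) by auto
  have "hall_rules A \<theta> (free_magma_le A n) ?X (list_order ss)"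
    by (rule hall_rules_restrict[OF hall _ n HOL.refl order]) (auto simp: free_magma_le_def)
  then have run: "lazard_run A \<theta> n ss (active ss)"
    using hall_rules_lazard_run[OF assms(4) ss(3), of A n] ss(2) by simp
  have "\<exists>as. complete_elimination_string (commutation_graph A \<theta> (active ss i)) as \<and> as \<noteq> [] \<and> hd as = ss ! i"
    if i: "i < length ss" for i
  proof -
    let ?V = "active ss i"
    \<comment> \<open>The complete elimination string lists the vertices in decreasing order. It
      starts with \<open>ss ! i\<close>, which is active and the greatest tree not yet
      eliminated.\<close>
    define as where "as = filter (\<lambda>t. t \<in> ?V) (drop i ss)"
    have V: "?V \<subseteq> ?X"
      using ss(2) by (auto simp: active_def dest: in_set_dropD)
    have set_as: "set as = ?V"
      by (auto simp: as_def active_def)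
    have "ss ! i \<in> ?V"
      using run i by (simp add: lazard_run_def)
    then have hd: "as \<noteq> []" "hd as = ss ! i"
      using i by (simp_all add: as_def Cons_nth_drop_Suc[symmetric])
    have dist: "distinct as"
      using ss(3) by (simp add: as_def)
    have sorted: "sorted_wrt (\<lambda>s t. (t, s) \<in> r) as"
      using ss(1) by (simp add: as_def sorted_wrt_filter sorted_wrt_drop)
    have fst: "fst (commutation_graph A \<theta> ?V) = ?V"
      by (simp add: commutation_graph_def)
    have V_free: "?V \<subseteq> free_magma A"
      using V assms(5) by auto
    \<comment> \<open>Every entry \<open>v\<close> of the string meets the hypotheses of
      \<open>transitive_Hall_set_commuting\<close>, not just the first: later vertices are below
      \<open>v\<close>, while their right factors lie among the first \<open>i\<close> entries of
      \<open>ss\<close> and so are above \<open>v\<close>.\<close>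
    have elim: "indep \<theta> z v \<or> indep \<theta> z' v"
      if k: "k < length as" "v = as ! k" and z: "z \<in> ?V - set (take (Suc k) as)"
        and z': "z' \<in> ?V - set (take (Suc k) as)" and "indep \<theta> z z'" for k v z z'
    proof -
      have v: "v \<in> ?V" "v \<in> set (take (Suc k) as)"
        using nth_mem[OF k(1)] nth_in_take_iff[OF dist k(1), of "Suc k"] k(2) set_as by simp_all
      have below: "t \<in> H" "(t, v) \<in> r" "t \<noteq> v" and above: "t = Br x y \<Longrightarrow> (v, y) \<in> r"
        if t: "t \<in> ?V - set (take (Suc k) as)" for t x y
      proof -
        have "t \<in> set as"
          using t set_as by simp
        then obtain l where l: "l < length as" "t = as ! l"
          unfolding in_set_conv_nth by blast
        then have "k < l"
          using t nth_in_take_iff[OF dist l(1), of "Suc k"] by simp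
        then show "(t, v) \<in> r"
          using sorted_wrt_nth_less[OF sorted, of k l] k l by simp
        show "t \<in> H" "t \<noteq> v"
          using t v(2) V by blast+
        assume "t = Br x y"
        then have "y \<in> set (take i ss)"
          using t by (auto simp: active_def)
        then obtain p where p: "p < i" "y = ss ! p"
          using i by (auto simp: in_set_conv_nth)
        obtain j where j: "i \<le> j" "j < length ss" "v = ss ! j"
          using v(1) in_set_drop_nth[OF ss(3)] unfolding active_def by blast
        show "(v, y) \<in> r"
          using sorted_wrt_nth_less[OF ss(1), of p j] p j by simp
      qed
      have "v \<in> H"
        using v(1) V by auto
      then show ?thesis
        by (rule transitive_Hall_set_commuting[OF assms(3-6) _ below[OF z] above[OF z]
              below[OF z'] above[OF z'] \<open>indep \<theta> z z'\<close>])
    qed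
    have "complete_elimination_string (commutation_graph A \<theta> ?V) as"
      unfolding complete_elimination_string_def elimination_string_def fst
        edge_commutation_graph_iff[OF assms(3,4) V_free]
    proof (intro conjI allI ballI impI)
      fix k z z' assume k: "k < length as" and "z \<in> ?V - set (take (Suc k) as)"
        "z' \<in> ?V - set (take (Suc k) as)" "z \<in> ?V \<and> z' \<in> ?V \<and> indep \<theta> z z'"
      then show "z \<in> ?V \<and> as ! k \<in> ?V \<and> indep \<theta> z (as ! k) \<or> z' \<in> ?V \<and> as ! k \<in> ?V \<and> indep \<theta> z' (as ! k)"
        using elim[OF k HOL.refl, of z z'] nth_mem[OF k] set_as by simp
    qed (simp_all add: set_as dist)
    then show ?thesis using hd by blast
  qed
  then show "\<exists>ss V. distinct ss \<and> set ss = H \<inter> free_magma_le A n \<and> lazard_run A \<theta> n ss V \<and>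
      (\<forall>i < length ss. \<exists>as. complete_elimination_string (commutation_graph A \<theta> (V i)) as \<and>
        as \<noteq> [] \<and> hd as = ss ! i)"
    using ss(2,3) run by blast
qed

section \<open>From Lazard sets to Hall sets\<close>

text \<open>The enumerations in different degrees need not be compatible; a compatible family of orders is
  extracted by compactness.\<close>

lemma ex_limit_relation:
  fixes R :: "nat \<Rightarrow> ('b \<times> 'b) set"
  assumes "\<And>n. finite (X n)"
  shows "\<exists>r \<subseteq> (\<Union>n. X n) \<times> (\<Union>n. X n).
    \<forall>n. \<exists>m\<ge>n. \<forall>s\<in>X n. \<forall>t\<in>X n. (s, t) \<in> r \<longleftrightarrow> (s, t) \<in> R m"
proof -
  \<comment> \<open>Infinite index sets on which the restriction of \<open>R\<close> to
    \<open>X n\<close> is constant. By pigeonhole every infinite index set contains such a set, so a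
    decreasing sequence of them exists.\<close>
  define P where "P n I \<longleftrightarrow> infinite I \<and>
    (\<forall>m\<in>I. \<forall>m'\<in>I. R m \<inter> X n \<times> X n = R m' \<inter> X n \<times> X n)" for n and I :: "nat set"
  have refine: "\<exists>I'\<subseteq>I. P n I'" if "infinite I" for n I
  proof -
    have "finite ((\<lambda>m. R m \<inter> X n \<times> X n) ` I)"
      by (rule finite_subset[of _ "Pow (X n \<times> X n)"]) (use assms in auto)
    from pigeonhole_infinite[OF that this] obtain m where
      "infinite {k \<in> I. R k \<inter> X n \<times> X n = R m \<inter> X n \<times> X n}"
      by auto
    then show ?thesis
      by (intro exI[of _ "{k \<in> I. R k \<inter> X n \<times> X n = R m \<inter> X n \<times> X n}"]) (simp add: P_def)
  qed
  have "\<exists>I. \<forall>n. P n (I n) \<and> I (Suc n) \<subseteq> I n"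
  proof (rule dependent_nat_choice)
    show "\<exists>I. P 0 I"
      using refine[OF infinite_UNIV_nat, of 0] by blast
    show "\<exists>I'. P (Suc n) I' \<and> I' \<subseteq> I" if "P n I" for n I
      using refine[of I "Suc n"] that unfolding P_def by blast
  qed
  then obtain I where I: "\<And>n. P n (I n)" "\<And>n. I (Suc n) \<subseteq> I n"
    by blast
  have anti: "I k \<subseteq> I n" if "n \<le> k" for n k
    using lift_Suc_antimono_le[of I, OF I(2) that] .
  have unbounded: "\<exists>m. m \<in> I n \<and> n \<le> m" for n
  proof -
    have "\<not> I n \<subseteq> {..n}"
      using conjunct1[OF I(1)[of n, unfolded P_def]] finite_subset[of "I n" "{..n}"] by auto
    then show ?thesis
      by (auto simp: subset_iff not_le dest: less_imp_le)
  qed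
  \<comment> \<open>Diagonal choice; the bound \<open>n \<le> m n\<close> makes the order on
    \<open>X n\<close> come from an enumeration of degree above \<open>n\<close>.\<close>
  define m where "m n = (SOME k. k \<in> I n \<and> n \<le> k)" for n
  have m: "m n \<in> I n" "n \<le> m n" for n
    using someI_ex[OF unbounded[of n]] unfolding m_def[symmetric] by simp_all
  have agree: "(s, t) \<in> R a \<longleftrightarrow> (s, t) \<in> R b"
    if "a \<in> I n" "b \<in> I n" "s \<in> X n" "t \<in> X n" for n a b s t
  proof -
    have "R a \<inter> X n \<times> X n = R b \<inter> X n \<times> X n"
      by (rule bspec[OF bspec[OF conjunct2[OF I(1)[of n, unfolded P_def]] that(1)] that(2)])
    from arg_cong[OF this, of "\<lambda>Z. (s, t) \<in> Z"] show ?thesis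
      using that(3,4) by simp
  qed
  define r where "r = (\<Union>n. R (m n) \<inter> X n \<times> X n)"
  have "(s, t) \<in> r \<longleftrightarrow> (s, t) \<in> R (m n)" if st: "s \<in> X n" "t \<in> X n" for n s t
  proof
    assume "(s, t) \<in> r"
    then obtain k where k: "(s, t) \<in> R (m k)" "s \<in> X k" "t \<in> X k"
      by (auto simp: r_def)
    \<comment> \<open>This index lies in both \<open>I n\<close> and \<open>I k\<close>, and thus
      links the restrictions to \<open>X n\<close> and to \<open>X k\<close>.\<close>
    let ?q = "m (max n k)"
    have "?q \<in> I n" "?q \<in> I k"
      using m(1)[of "max n k"] anti[of n "max n k"] anti[of k "max n k"] by auto
    then show "(s, t) \<in> R (m n)"
      using agree[OF m(1) _ k(2,3), of ?q] agree[OF m(1) _ st, of ?q] k(1) by simp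
  next
    assume "(s, t) \<in> R (m n)"
    then show "(s, t) \<in> r"
      using st by (auto simp: r_def)
  qed
  then have "\<exists>k\<ge>n. \<forall>s\<in>X n. \<forall>t\<in>X n. (s, t) \<in> r \<longleftrightarrow> (s, t) \<in> R k" for n
    using m(2)[of n] by (intro exI[of _ "m n"]) simp
  moreover have "r \<subseteq> (\<Union>n. X n) \<times> (\<Union>n. X n)"
    by (auto simp: r_def)
  ultimately show ?thesis
    by (intro exI[of _ r]) simp
qed

text \<open>Each axiom of a linear order concerns at most three elements, so agreement with some
  linear order on every finite subset suffices.\<close>

lemma linear_order_on_local:
  assumes "r \<subseteq> L \<times> L"
    and order: "\<And>F. finite F \<Longrightarrow> F \<subseteq> L \<Longrightarrow>
      \<exists>Y q. linear_order_on Y q \<and> F \<subseteq> Y \<and> (\<forall>s\<in>F. \<forall>t\<in>F. (s, t) \<in> r \<longleftrightarrow> (s, t) \<in> q)"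
  shows "linear_order_on L r"
proof -
  have "refl_on L r"
  proof (rule refl_onI)
    fix s assume "s \<in> L"
    then have "finite {s}" "{s} \<subseteq> L"
      by auto
    from order[OF this] obtain Y q where "linear_order_on Y q" "s \<in> Y" "(s, s) \<in> r \<longleftrightarrow> (s, s) \<in> q"
      by blast
    then show "(s, s) \<in> r"
      by (simp add: order_on_defs refl_on_def)
  qed
  moreover have "trans r"
  proof (rule transI)
    fix s t u assume stu: "(s, t) \<in> r" "(t, u) \<in> r"
    then have "finite {s, t, u}" "{s, t, u} \<subseteq> L"
      using assms(1) by auto
    from order[OF this] obtain Y q where "linear_order_on Y q"
      and q: "\<forall>x\<in>{s, t, u}. \<forall>y\<in>{s, t, u}. (x, y) \<in> r \<longleftrightarrow> (x, y) \<in> q"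
      by (elim exE conjE) (rule that; assumption)
    then have "trans q"
      by (simp add: order_on_defs)
    then show "(s, u) \<in> r"
      using stu q transD[of q s t u] by simp
  qed
  moreover have "antisym r"
  proof (rule antisymI)
    fix s t assume st: "(s, t) \<in> r" "(t, s) \<in> r"
    then have "finite {s, t}" "{s, t} \<subseteq> L"
      using assms(1) by auto
    from order[OF this] obtain Y q where "linear_order_on Y q"
      and q: "\<forall>x\<in>{s, t}. \<forall>y\<in>{s, t}. (x, y) \<in> r \<longleftrightarrow> (x, y) \<in> q"
      by (elim exE conjE) (rule that; assumption)
    then have "antisym q"
      by (simp add: order_on_defs)
    then show "s = t"
      using st q antisymD[of q s t] by simp
  qed
  moreover have "total_on L r"
  proof (rule total_onI)
    fix s t assume st: "s \<in> L" "t \<in> L" "s \<noteq> t"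
    then have "finite {s, t}" "{s, t} \<subseteq> L"
      by auto
    from order[OF this] obtain Y q where Y: "linear_order_on Y q" "{s, t} \<subseteq> Y"
      and q: "\<forall>x\<in>{s, t}. \<forall>y\<in>{s, t}. (x, y) \<in> r \<longleftrightarrow> (x, y) \<in> q"
      by (elim exE conjE) (rule that; assumption)
    then have "(s, t) \<in> q \<or> (t, s) \<in> q"
      using st(3) unfolding order_on_defs total_on_def by simp
    then show "(s, t) \<in> r \<or> (t, s) \<in> r"
      using q by simp
  qed
  ultimately show ?thesis
    using assms(1) by (simp add: order_on_defs)
qed

lemma elim_chain_sorted_factorization:
  assumes "sym \<theta>" "distinct ss" "elim_chain A \<theta> n ss (Letter ` A)" "set w \<subseteq> A" "length w \<le> n"
  shows "\<exists>!x. set x \<subseteq> set ss \<and> sorted_wrt (\<lambda>s t. (t, s) \<in> list_order ss) x \<and>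
    (w, words x) \<in> trace_cong A \<theta>"
proof -
  have "linear_order_on (set ss) (list_order ss)"
    by (rule linear_order_list_order[OF assms(2)])
  then have "refl_on (set ss) ((list_order ss)\<inverse>)" "antisym ((list_order ss)\<inverse>)"
    by (simp_all add: order_on_defs refl_on_def)
  moreover have "sorted_wrt (\<lambda>s t. (s, t) \<in> (list_order ss)\<inverse>) ss"
    using assms(2) by (simp add: sorted_wrt_iff_nth_less list_order_nth_iff)
  ultimately have "is_normal_form ss x \<longleftrightarrow>
      set x \<subseteq> set ss \<and> sorted_wrt (\<lambda>s t. (t, s) \<in> list_order ss) x" for x
    using is_normal_form_iff[of ss "(list_order ss)\<inverse>" x] assms(2) by simp
  then show ?thesis
    using elim_chain_factorization[OF assms(1,3-5)] by (simp add: conj_assoc)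
qed

lemma free_magma_le_mono: "m \<le> n \<Longrightarrow> free_magma_le A m \<subseteq> free_magma_le A n"
  by (auto simp: free_magma_le_def)

lemma transitive_Lazard_imp_Hall:
  assumes "finite A" "\<theta> \<subseteq> A \<times> A" "sym \<theta>" "irrefl \<theta>" "L \<subseteq> free_magma A"
    "transitive_Lazard_set A \<theta> L"
  shows "\<exists>r. transitive_Hall_set A \<theta> L r"
proof -
  let ?X = "\<lambda>n. L \<inter> free_magma_le A n"
  define D where "D N us \<longleftrightarrow> distinct us \<and> set us = ?X N \<and>
      hall_rules A \<theta> (free_magma_le A N) (set us) (list_order us) \<and> elim_chain A \<theta> N us (Letter ` A)"
    for N us
  \<comment> \<open>Enumerations are given for positive degrees only, hence the shift by
    one.\<close>
  have "\<exists>us. D (Suc n) us" for n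
  proof -
    obtain us V where us: "distinct us" "set us = ?X (Suc n)" "lazard_run A \<theta> (Suc n) us V"
      and V: "\<forall>i < length us. eliminable \<theta> (us ! i) (V i)"
      using transitive_Lazard_set_run[OF assms(2-4,6), of "Suc n"] by blast
    have "hall_rules A \<theta> (free_magma_le A (Suc n)) (set us) (list_order us)"
      using lazard_run_hall_rules[OF assms(4) _ us(1) _ us(3)] us(2) by simp
    moreover have "elim_chain A \<theta> (Suc n) us (Letter ` A)"
      using us(3) V by (intro lazard_run_elim_chain[of _ _ _ _ V]) simp_all
    ultimately show ?thesis
      using us by (intro exI[of _ us]) (simp add: D_def)
  qed
  then obtain ss where ss: "\<And>n. D (Suc n) (ss n)"
    by metis
  have finite_X: "finite (?X n)" for n
    using finite_free_magma_le[OF assms(1)] by simp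
  obtain r where r: "r \<subseteq> (\<Union>n. ?X n) \<times> (\<Union>n. ?X n)"
    "\<And>n. \<exists>m\<ge>n. \<forall>s\<in>?X n. \<forall>t\<in>?X n. (s, t) \<in> r \<longleftrightarrow> (s, t) \<in> list_order (ss m)"
    using ex_limit_relation[of ?X "\<lambda>m. list_order (ss m)", OF finite_X] by blast
  have in_X: "s \<in> ?X n" if "s \<in> L" "num_leaves s \<le> n" for s n
    using that assms(5) by (auto simp: free_magma_le_def)
  have level: "\<exists>N us. n < N \<and> D N us \<and> (\<forall>s\<in>?X n. \<forall>t\<in>?X n. (s, t) \<in> r \<longleftrightarrow> (s, t) \<in> list_order us)"
    for n
  proof -
    obtain m where "n \<le> m" "\<forall>s\<in>?X n. \<forall>t\<in>?X n. (s, t) \<in> r \<longleftrightarrow> (s, t) \<in> list_order (ss m)"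
      using r(2) by blast
    then show ?thesis
      using ss[of m] by (intro exI[of _ "Suc m"] exI[of _ "ss m"]) simp
  qed
  have subset: "?X n \<subseteq> ?X N" if "n < N" for n N
    using that free_magma_le_mono[of n N A] by auto
  have lin: "linear_order_on L r"
  proof (rule linear_order_on_local)
    show "r \<subseteq> L \<times> L"
      using r(1) by auto
    fix F assume F: "finite F" "F \<subseteq> L"
    \<comment> \<open>A crude common bound for the numbers of leaves of all trees in
      \<open>F\<close>.\<close>
    let ?n = "\<Sum>t\<in>F. num_leaves t"
    have "F \<subseteq> ?X ?n"
    proof
      fix t assume "t \<in> F"
      then show "t \<in> ?X ?n"
        using F by (intro in_X member_le_sum) auto
    qed
    moreover obtain N us where N: "?n < N" "D N us"
      "\<forall>s\<in>?X ?n. \<forall>t\<in>?X ?n. (s, t) \<in> r \<longleftrightarrow> (s, t) \<in> list_order us"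
      using level[of ?n] by (elim exE conjE) (rule that; assumption)
    moreover have "linear_order_on (set us) (list_order us)"
      using N(2) by (intro linear_order_list_order) (simp add: D_def)
    moreover have "?X ?n \<subseteq> set us"
      using N(2) subset[OF N(1)] by (simp add: D_def)
    ultimately show "\<exists>Y q. linear_order_on Y q \<and> F \<subseteq> Y \<and> (\<forall>s\<in>F. \<forall>t\<in>F. (s, t) \<in> r \<longleftrightarrow> (s, t) \<in> q)"
      by (intro exI[of _ "set us"] exI[of _ "list_order us"]) (simp add: subset_iff)
  qed
  have hall_le: "hall_rules A \<theta> (free_magma_le A n) (?X n) r" if n: "n > 0" for n
  proof -
    obtain N us where N: "n < N" "D N us"
      and agree: "\<forall>s\<in>?X n. \<forall>t\<in>?X n. (s, t) \<in> r \<longleftrightarrow> (s, t) \<in> list_order us"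
      using level[of n] by (elim exE conjE) (rule that; assumption)
    have le: "free_magma_le A n \<subseteq> free_magma_le A N"
      using N(1) by (intro free_magma_le_mono) simp
    have us: "set us = ?X N" "hall_rules A \<theta> (free_magma_le A N) (set us) (list_order us)"
      using N(2) unfolding D_def by blast+
    show ?thesis
      using us(2) le n
    proof (rule hall_rules_restrict)
      show "?X n = set us \<inter> free_magma_le A n"
        using us(1) le by blast
    qed (use agree in simp)
  qed
  have hall: "hall_rules A \<theta> (free_magma A) L r"
  proof (rule hall_rulesI)
    show "Letter ` A \<subseteq> L"
      using hall_rulesD(1)[OF hall_le[of 1]] by auto
    fix x y :: "'a mtree"
    \<comment> \<open>The rules for \<open>Br x y\<close> involve only its subtrees, so its own
      number of leaves is a large enough degree.\<close>
    let ?n = "num_leaves (Br x y)"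
    note H = hall_rulesD[OF hall_le[of ?n, OF num_leaves_pos]]
    show "y \<in> L \<and> (Br x y, y) \<in> r \<and> Br x y \<noteq> y" if "Br x y \<in> L"
      using H(2)[of x y] in_X[OF that order.refl] by simp
    assume U: "Br x y \<in> free_magma A"
    then have le: "Br x y \<in> free_magma_le A ?n"
      by (simp add: free_magma_le_def)
    then have le': "x \<in> free_magma_le A ?n" "y \<in> free_magma_le A ?n"
      using free_magma_le_Br by blast+
    show "Br x y \<in> L \<longleftrightarrow> x \<in> L \<and> y \<in> L \<and> (x, y) \<in> r \<and> x \<noteq> y \<and> \<not> indep \<theta> x y \<and>
        (x \<in> Letter ` A \<or> (\<exists>x' y'. x = Br x' y' \<and> (y, y') \<in> r))"
      using H(3)[OF le] le le' by (simp only: Int_iff simp_thms)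
  qed
  have "\<exists>!x. set x \<subseteq> L \<and> sorted_wrt (\<lambda>s t. (t, s) \<in> r) x \<and> (w, words x) \<in> trace_cong A \<theta>"
    if w: "set w \<subseteq> A" for w
  proof -
    obtain N us where N: "length w < N" and D: "D N us"
      and agree: "\<forall>s\<in>?X (length w). \<forall>t\<in>?X (length w). (s, t) \<in> r \<longleftrightarrow> (s, t) \<in> list_order us"
      using level[of "length w"] by (elim exE conjE) (rule that; assumption)
    have us: "distinct us" "set us = ?X N" "elim_chain A \<theta> N us (Letter ` A)"
      using D by (simp_all add: D_def)
    \<comment> \<open>Factors of a trace have at most as many leaves as the trace has letters. They
      all lie in the truncation on which \<open>r\<close> agrees with the order of the enumeration,
      so both notions of decreasing factorization coincide.\<close>
    have iff: "set x \<subseteq> set us \<and> sorted_wrt (\<lambda>s t. (t, s) \<in> list_order us) x \<and> (w, words x) \<in> trace_cong A \<theta> \<longleftrightarrow>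
        set x \<subseteq> L \<and> sorted_wrt (\<lambda>s t. (t, s) \<in> r) x \<and> (w, words x) \<in> trace_cong A \<theta>" for x
    proof (cases "set x \<subseteq> L \<and> (w, words x) \<in> trace_cong A \<theta>")
      case True
      have X: "s \<in> ?X (length w)" if "s \<in> set x" for s
        using True num_leaves_le_words[OF that] trace_cong_length[of w "words x" A \<theta>] that
        by (intro in_X) auto
      then have "set x \<subseteq> set us"
        using us(2) subset[OF N] by blast
      moreover have "sorted_wrt (\<lambda>s t. (t, s) \<in> list_order us) x \<longleftrightarrow> sorted_wrt (\<lambda>s t. (t, s) \<in> r) x"
        using X agree by (simp add: sorted_wrt_iff_nth_less)
      ultimately show ?thesis
        using True by simp
    next
      case False
      moreover have "set us \<subseteq> L"
        using us(2) by simp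
      ultimately show ?thesis by blast
    qed
    show ?thesis
      using elim_chain_sorted_factorization[OF assms(3) us(1,3) w] N unfolding iff by simp
  qed
  then show ?thesis
    using lin hall unfolding transitive_Hall_set_iff[OF assms(3-5)] by (intro exI[of _ r]) simp
qed

theorem theorem4:
  fixes A :: "'a set" and \<theta> :: "('a \<times> 'a) set" and L :: "'a mtree set"
  assumes "finite A"
    and "\<theta> \<subseteq> A \<times> A" and "sym \<theta>" and "irrefl \<theta>"
    and "L \<subseteq> free_magma A"
  shows "transitive_Lazard_set A \<theta> L \<longleftrightarrow> (\<exists>r. transitive_Hall_set A \<theta> L r)"
  using transitive_Lazard_imp_Hall[OF assms] transitive_Hall_imp_Lazard[OF assms] by blast
end
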